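(* Let $p>1$, let $\rho=(\rho_m)$ be a sequence of partitions of $[0,T]$ with vanishing mesh, and let $x\in C([0,T];\mathbb R)\cap V_p(\rho)$. For any partition sequence $\pi=(\pi_n)$ of $[0,T]$ with vanishing mesh, the following are equivalent: (i) $x\in\mathcal D^p_{\pi\mid\rho}$; (ii) $x\in V_p(\pi)$ and $[x]^p_\pi=[x]^p_\rho$; (iii) for every $t\in[0,T]$, $\nu^{p,x}_{\pi_n,t}\Longrightarrow\nu^{p,x}_t$ weakly as $n\to\infty$; (iv) for some alignment $\rho^\star$ of $\rho$ with $\pi$ along $x$, $\widehat\eta^{\,p,x}_{\pi,\rho^\star;n}(t,\xi)\to0$ as $n\to\infty$ for every $(t,\xi)\in[0,T]\times\mathbb R$; (v) for every alignment $\rho^\star$ of $\rho$ with $\pi$ along $x$, $\widehat\eta^{\,p,x}_{\pi,\rho^\star;n}(t,\xi)\to0$ as $n\to\infty$ for every $(t,\xi)\in[0,T]\times\mathbb R$.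
   Context: $\omega_x(h):=\sup\{|x(t)-x(s)|:|t-s|\le h\}$; $N(\lambda)$ is the number of intervals of a partition $\lambda$ and $|\lambda|$ its mesh. Finite $p$-th variation: for a partition sequence $\lambda=(\lambda_n)$, $\lambda_n=\{0=u^n_0<\dots<u^n_{N(\lambda_n)}=T\}$, with vanishing mesh, $x\in V_p(\lambda)$ means that the measures $\sum_i|x(u^n_{i+1})-x(u^n_i)|^p\delta_{u^n_i}$ converge weakly to a finite nonatomic Borel measure $\mu^{p,x}_\lambda$ on $[0,T]$; then $[x]^p_\lambda(t):=\mu_\lambda^{p,x}([0,t])$. Occupation measures: $\nu^{p,x}_{\lambda_n,t}:=\sum_i|x(u^n_{i+1}\wedge t)-x(u^n_i\wedge t)|^p\,\delta_{x(u^n_i\wedge t)}$, and $\nu^{p,x}_t:=x_\#(\mu^{p,x}_\rho|_{[0,t]})$ (push-forward under $s\mapsto x(s)$ of the restriction to $[0,t]$). Fourier transform of a finite signed measure on $\mathbb R$: $\widehat\nu(\xi)=\int e^{i\xi y}\nu(dy)$. Alignment: for a strictly increasing $r:\mathbb N\to\mathbb N$ put $\rho^\star_n:=\rho_{r(n)}$, $h_n:=|\rho^\star_n|$. $\rho^\star$ is an alignment of $\rho$ with $\pi$ along $x$ if $N(\pi_n)\omega_x(h_n)^p\to0$. Write $\pi_n=\{0=t^n_0<\dots<t^n_{N_n}=T\}$, $\rho^\star_n=\{0=s^n_0<\dots<s^n_{M_n}=T\}$, $\kappa_n(0)=0$, $\kappa_n(N_n)=M_n$, $\kappa_n(k)=\min\{j:s^n_j\ge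 t^n_k\}$; $\delta_{j,n}(t):=x(s^n_{j+1}\wedge t)-x(s^n_j\wedge t)$, $C_{k,n}(t):=\sum_{j=\kappa_n(k)}^{\kappa_n(k+1)-1}\delta_{j,n}(t)$, and block errors $\mathfrak D^p_{k,n}(x;t):=|C_{k,n}(t)|^p-\sum_{j=\kappa_n(k)}^{\kappa_n(k+1)-1}|\delta_{j,n}(t)|^p$. $x\in\mathcal D^p_{\pi\mid\rho}$ means that for some alignment $\rho^\star$, $\sum_{k=0}^{N_n-1}\mathfrak D^p_{k,n}(x;t)\to0$ as $n\to\infty$ for every $t\in[0,T]$. Signed coarse-graining error measure: $\eta^{p,x}_{\pi,\rho^\star;n}(t):=\sum_{k=0}^{N_n-1}\mathfrak D^p_{k,n}(x;t)\,\delta_{x(t^n_k)}$, with Fourier transform $\widehat\eta^{\,p,x}_{\pi,\rho^\star;n}(t,\xi)$. *)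

theory Defs
  imports "HOL-Probability.Probability"
begin

section \<open>Partitions, oscillation, alignment\<close>

text \<open>
  A partition \<open>0 = u\<^sub>0 < \<dots> < u\<^sub>N = T\<close> is the list of its points; it has \<open>N = length u - 1\<close> intervals.
\<close>

definition is_partition :: "real \<Rightarrow> real list \<Rightarrow> bool" where
  "is_partition T u \<longleftrightarrow> u \<noteq> [] \<and> sorted_wrt (<) u \<and> hd u = 0 \<and> last u = T"

definition num_intervals :: "real list \<Rightarrow> nat" where
  "num_intervals u = length u - 1"

definition mesh :: "real list \<Rightarrow> real" where
  "mesh u = (MAX i\<in>{..<num_intervals u}. u ! Suc i - u ! i)"

definition vanishing_partitions :: "real \<Rightarrow> (nat \<Rightarrow> real list) \<Rightarrow> bool" where
  "vanishing_partitions T u \<longleftrightarrow> (\<forall>n. is_partition T (u n)) \<and> (\<lambda>n. mesh (u n)) \<longlonglongrightarrow> 0"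

definition osc :: "real \<Rightarrow> (real \<Rightarrow> real) \<Rightarrow> real \<Rightarrow> real" where
  "osc T x h = Sup {\<bar>x t - x s\<bar> | s t. s \<in> {0..T} \<and> t \<in> {0..T} \<and> \<bar>t - s\<bar> \<le> h}"

text \<open>The alignment is given by the index map \<open>r\<close>; the aligned sequence is \<open>\<rho> \<circ> r\<close>.\<close>

definition is_alignment ::
  "real \<Rightarrow> real \<Rightarrow> (real \<Rightarrow> real) \<Rightarrow> (nat \<Rightarrow> real list) \<Rightarrow> (nat \<Rightarrow> real list) \<Rightarrow> (nat \<Rightarrow> nat) \<Rightarrow> bool" where
  "is_alignment T p x \<pi> \<rho> r \<longleftrightarrow> strict_mono r \<and>
     (\<lambda>n. real (num_intervals (\<pi> n)) * osc T x (mesh (\<rho> (r n))) powr p) \<longlonglongrightarrow> 0"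


section \<open>Measures and weak convergence\<close>

definition weakly_converges :: "(nat \<Rightarrow> 'a::topological_space measure) \<Rightarrow> 'a measure \<Rightarrow> bool" where
  "weakly_converges M L \<longleftrightarrow>
     (\<forall>f :: 'a \<Rightarrow> real. continuous_on (space L) f \<and> bounded (f ` space L) \<longrightarrow>
        (\<lambda>n. \<integral>y. f y \<partial>M n) \<longlonglongrightarrow> (\<integral>y. f y \<partial>L))"

definition nonatomic :: "'a measure \<Rightarrow> bool" where
  "nonatomic M \<longleftrightarrow> (\<forall>A\<in>sets M. emeasure M A > 0 \<longrightarrow>
     (\<exists>B\<in>sets M. B \<subseteq> A \<and> 0 < emeasure M B \<and> emeasure M B < emeasure M A))"

text \<open>
  \<open>\<Sum>i<N. w i \<cdot> \<delta>\<^bsub>a i\<^esub>\<close> for nonnegative weights, as the push-forward of a weighted counting measure.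
\<close>

definition weighted_diracs :: "'a measure \<Rightarrow> nat \<Rightarrow> (nat \<Rightarrow> real) \<Rightarrow> (nat \<Rightarrow> 'a) \<Rightarrow> 'a measure" where
  "weighted_diracs S N w a = distr (point_measure {..<N} (\<lambda>i. ennreal (w i))) S a"


section \<open>Finite p-th variation and occupation measures\<close>

definition variation_measure :: "real \<Rightarrow> real \<Rightarrow> (real \<Rightarrow> real) \<Rightarrow> real list \<Rightarrow> real measure" where
  "variation_measure T p x u =
     weighted_diracs (restrict_space borel {0..T}) (num_intervals u)
       (\<lambda>i. \<bar>x (u ! Suc i) - x (u ! i)\<bar> powr p) (\<lambda>i. u ! i)"

definition is_limit_variation ::
  "real \<Rightarrow> real \<Rightarrow> (nat \<Rightarrow> real list) \<Rightarrow> (real \<Rightarrow> real) \<Rightarrow> real measure \<Rightarrow> bool" where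
  "is_limit_variation T p u x \<mu> \<longleftrightarrow>
     sets \<mu> = sets (restrict_space borel {0..T}) \<and> finite_measure \<mu> \<and> nonatomic \<mu> \<and>
     weakly_converges (\<lambda>n. variation_measure T p x (u n)) \<mu>"

definition V_class :: "real \<Rightarrow> real \<Rightarrow> (nat \<Rightarrow> real list) \<Rightarrow> (real \<Rightarrow> real) set" where
  "V_class T p u = {x. \<exists>\<mu>. is_limit_variation T p u x \<mu>}"

text \<open>Weak limits being unique, this is meaningful for \<open>x \<in> V_class T p u\<close>.\<close>

definition limit_variation ::
  "real \<Rightarrow> real \<Rightarrow> (nat \<Rightarrow> real list) \<Rightarrow> (real \<Rightarrow> real) \<Rightarrow> real measure" where
  "limit_variation T p u x = (THE \<mu>. is_limit_variation T p u x \<mu>)"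

definition pth_variation ::
  "real \<Rightarrow> real \<Rightarrow> (nat \<Rightarrow> real list) \<Rightarrow> (real \<Rightarrow> real) \<Rightarrow> real \<Rightarrow> real" where
  "pth_variation T p u x t = measure (limit_variation T p u x) {0..t}"

definition occupation_measure ::
  "real \<Rightarrow> (real \<Rightarrow> real) \<Rightarrow> real list \<Rightarrow> real \<Rightarrow> real measure" where
  "occupation_measure p x u t =
     weighted_diracs borel (num_intervals u)
       (\<lambda>i. \<bar>x (min (u ! Suc i) t) - x (min (u ! i) t)\<bar> powr p) (\<lambda>i. x (min (u ! i) t))"

definition limit_occupation ::
  "real \<Rightarrow> real \<Rightarrow> (nat \<Rightarrow> real list) \<Rightarrow> (real \<Rightarrow> real) \<Rightarrow> real \<Rightarrow> real measure" where
  "limit_occupation T p \<rho> x t = distr (restrict_space (limit_variation T p \<rho> x) {0..t}) borel x"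


section \<open>Block errors\<close>

text \<open>In this section \<open>u\<close> is the coarse partition \<open>(t\<^sub>k)\<close> and \<open>v\<close> the fine partition \<open>(s\<^sub>j)\<close>.\<close>

definition kappa :: "real list \<Rightarrow> real list \<Rightarrow> nat \<Rightarrow> nat" where
  "kappa u v k =
     (if k = 0 then 0
      else if k = num_intervals u then num_intervals v
      else (LEAST j. j \<le> num_intervals v \<and> v ! j \<ge> u ! k))"

definition increment :: "(real \<Rightarrow> real) \<Rightarrow> real list \<Rightarrow> real \<Rightarrow> nat \<Rightarrow> real" where
  "increment x v t j = x (min (v ! Suc j) t) - x (min (v ! j) t)"

definition block_increment ::
  "(real \<Rightarrow> real) \<Rightarrow> real list \<Rightarrow> real list \<Rightarrow> real \<Rightarrow> nat \<Rightarrow> real" where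
  "block_increment x u v t k = (\<Sum>j\<in>{kappa u v k..<kappa u v (Suc k)}. increment x v t j)"

definition block_error ::
  "real \<Rightarrow> (real \<Rightarrow> real) \<Rightarrow> real list \<Rightarrow> real list \<Rightarrow> real \<Rightarrow> nat \<Rightarrow> real" where
  "block_error p x u v t k =
     \<bar>block_increment x u v t k\<bar> powr p
       - (\<Sum>j\<in>{kappa u v k..<kappa u v (Suc k)}. \<bar>increment x v t j\<bar> powr p)"

definition D_class ::
  "real \<Rightarrow> real \<Rightarrow> (nat \<Rightarrow> real list) \<Rightarrow> (nat \<Rightarrow> real list) \<Rightarrow> (real \<Rightarrow> real) set" where
  "D_class T p \<pi> \<rho> = {x. \<exists>r. is_alignment T p x \<pi> \<rho> r \<and>
     (\<forall>t\<in>{0..T}.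
        (\<lambda>n. \<Sum>k<num_intervals (\<pi> n). block_error p x (\<pi> n) (\<rho> (r n)) t k) \<longlonglongrightarrow> 0)}"


section \<open>The signed coarse-graining error measure and its Fourier transform\<close>

text \<open>
  Finite signed Borel measures on the line are represented by their set functions. Integration
  against a signed measure is the difference of the integrals against the two parts of a
  decomposition into finite positive measures. The value does not depend on the
  decomposition, which need not be the Jordan one; see \<open>fourier_eqI\<close> below.
\<close>

definition signed_decomposition :: "(real set \<Rightarrow> real) \<Rightarrow> real measure \<Rightarrow> real measure \<Rightarrow> bool" where
  "signed_decomposition \<eta> P N \<longleftrightarrow>
     sets P = sets borel \<and> sets N = sets borel \<and> finite_measure P \<and> finite_measure N \<and>
     (\<forall>B\<in>sets borel. \<eta> B = measure P B - measure N B)"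

definition fourier :: "(real set \<Rightarrow> real) \<Rightarrow> real \<Rightarrow> complex" where
  "fourier \<eta> \<xi> = (THE z. \<exists>P N. signed_decomposition \<eta> P N \<and> z = char P \<xi> - char N \<xi>)"

definition coarse_error ::
  "real \<Rightarrow> (real \<Rightarrow> real) \<Rightarrow> real list \<Rightarrow> real list \<Rightarrow> real \<Rightarrow> real set \<Rightarrow> real" where
  "coarse_error p x u v t B =
     (\<Sum>k<num_intervals u. block_error p x u v t k * indicator B (x (u ! k)))"

lemma nn_integral_decomposition_unique:
  assumes 1: "signed_decomposition \<eta> P N" and 2: "signed_decomposition \<eta> P' N'"
    and f: "f \<in> borel_measurable borel"
  shows "(\<integral>\<^sup>+y. f y \<partial>P) + (\<integral>\<^sup>+y. f y \<partial>N') = (\<integral>\<^sup>+y. f y \<partial>P') + (\<integral>\<^sup>+y. f y \<partial>N)"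
proof -
  note [simp] = 1[unfolded signed_decomposition_def, THEN conjunct1]
    1[unfolded signed_decomposition_def, THEN conjunct2, THEN conjunct1]
    2[unfolded signed_decomposition_def, THEN conjunct1]
    2[unfolded signed_decomposition_def, THEN conjunct2, THEN conjunct1]
  note [measurable_cong] = this
  interpret P: finite_measure P using 1 by (simp add: signed_decomposition_def)
  interpret N: finite_measure N using 1 by (simp add: signed_decomposition_def)
  interpret P': finite_measure P' using 2 by (simp add: signed_decomposition_def)
  interpret N': finite_measure N' using 2 by (simp add: signed_decomposition_def)
  from f show ?thesis
  proof (induction rule: borel_measurable_induct)
    case (cong f g)
    then have "f = g" by auto
    then show ?case using cong by simp
  next
    case (set A)
    have "measure P A - measure N A = measure P' A - measure N' A"
      using 1 2 set unfolding signed_decomposition_def by metis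
    then have "measure P A + measure N' A = measure P' A + measure N A" by linarith
    then have "emeasure P A + emeasure N' A = emeasure P' A + emeasure N A"
      by (simp add: P.emeasure_eq_measure N.emeasure_eq_measure P'.emeasure_eq_measure
          N'.emeasure_eq_measure flip: ennreal_plus)
    then show ?case using set by simp
  next
    case (mult u c)
    then show ?case by (simp add: nn_integral_cmult flip: distrib_left)
  next
    case (add u v)
    then show ?case by (simp add: nn_integral_add) (metis (no_types, lifting) add.assoc add.left_commute)
  next
    case (seq U)
    have *: "(\<integral>\<^sup>+y. (SUP i. U i) y \<partial>M) = (SUP i. \<integral>\<^sup>+y. U i y \<partial>M)" if "sets M = sets borel" for M
    proof -
      have "U i \<in> borel_measurable M" for i
        unfolding measurable_cong_sets[OF that refl] by (rule seq)
      with seq show ?thesis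
        by (simp add: nn_integral_monotone_convergence_SUP SUP_apply[abs_def])
    qed
    have inc: "incseq (\<lambda>i. \<integral>\<^sup>+y. U i y \<partial>M)" for M
      using seq by (auto simp: incseq_def le_fun_def intro!: nn_integral_mono)
    show ?case
      unfolding *[OF 1[unfolded signed_decomposition_def, THEN conjunct1]]
        *[OF 1[unfolded signed_decomposition_def, THEN conjunct2, THEN conjunct1]]
        *[OF 2[unfolded signed_decomposition_def, THEN conjunct1]]
        *[OF 2[unfolded signed_decomposition_def, THEN conjunct2, THEN conjunct1]]
      using seq by (simp add: inc flip: ennreal_SUP_add)
  qed
qed

lemma integral_decomposition_unique:
  fixes f :: "real \<Rightarrow> real"
  assumes 1: "signed_decomposition \<eta> P N" and 2: "signed_decomposition \<eta> P' N'"
    and f: "f \<in> borel_measurable borel" and b: "\<And>y. \<bar>f y\<bar> \<le> 1"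
  shows "(\<integral>y. f y \<partial>P) - (\<integral>y. f y \<partial>N) = (\<integral>y. f y \<partial>P') - (\<integral>y. f y \<partial>N')"
proof -
  have key: "(\<integral>y. g y \<partial>P) + (\<integral>y. g y \<partial>N') = (\<integral>y. g y \<partial>P') + (\<integral>y. g y \<partial>N)"
    if g: "g \<in> borel_measurable borel" "\<And>y. 0 \<le> g y" "\<And>y. g y \<le> 2" for g :: "real \<Rightarrow> real"
  proof -
    have nn: "(\<integral>\<^sup>+y. ennreal (g y) \<partial>M) = ennreal (\<integral>y. g y \<partial>M)"
      if "sets M = sets borel" "finite_measure M" for M
    proof (rule nn_integral_eq_integral)
      interpret finite_measure M by fact
      have "g \<in> borel_measurable M" unfolding measurable_cong_sets[OF that(1) refl] by (rule g)
      then show "integrable M g"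
        using g by (intro integrable_const_bound[where B=2]) auto
    qed (use g in auto)
    have [simp]: "0 \<le> (\<integral>y. g y \<partial>M)" for M using g by simp
    show ?thesis
      using nn_integral_decomposition_unique[OF 1 2, of "\<lambda>y. ennreal (g y)"] g 1 2
      by (simp add: nn signed_decomposition_def flip: ennreal_plus)
  qed
  have int: "(\<integral>y. f y + 1 \<partial>M) = (\<integral>y. f y \<partial>M) + (\<integral>y. 1 \<partial>M)"
    if "sets M = sets borel" "finite_measure M" for M
  proof (rule Bochner_Integration.integral_add)
    interpret finite_measure M by fact
    have "f \<in> borel_measurable M" unfolding measurable_cong_sets[OF that(1) refl] by (rule f)
    then show "integrable M f"
      using b by (intro integrable_const_bound[where B=1]) auto
  qed (use that in \<open>simp add: finite_measure.emeasure_finite less_top[symmetric] finite_measure.integrable_const\<close>)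
  have "0 \<le> f y + 1" "f y + 1 \<le> 2" for y using b[of y] by auto
  then show ?thesis
    using key[of "\<lambda>y. f y + 1"] key[of "\<lambda>y. 1"] f 1 2
    by (simp add: int signed_decomposition_def del: lebesgue_integral_const)
qed

lemma fourier_eqI:
  assumes "signed_decomposition \<eta> P N"
  shows "fourier \<eta> \<xi> = char P \<xi> - char N \<xi>"
  unfolding fourier_def
proof (rule the_equality)
  fix z assume "\<exists>P' N'. signed_decomposition \<eta> P' N' \<and> z = char P' \<xi> - char N' \<xi>"
  then obtain P' N' where z: "signed_decomposition \<eta> P' N'" "z = char P' \<xi> - char N' \<xi>" by blast
  have c: "Re (char M \<xi>) = (\<integral>y. cos (\<xi> * y) \<partial>M)" "Im (char M \<xi>) = (\<integral>y. sin (\<xi> * y) \<partial>M)"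
    if "sets M = sets borel" "finite_measure M" for M
  proof -
    interpret finite_measure M by fact
    have "(\<lambda>y. iexp (\<xi> * y)) \<in> borel_measurable M"
      unfolding measurable_cong_sets[OF that(1) refl] by measurable
    then have "integrable M (\<lambda>y. iexp (\<xi> * y))"
      by (intro integrable_const_bound[where B=1]) auto
    from integral_Re[OF this] integral_Im[OF this]
    show "Re (char M \<xi>) = (\<integral>y. cos (\<xi> * y) \<partial>M)" "Im (char M \<xi>) = (\<integral>y. sin (\<xi> * y) \<partial>M)"
      by (simp_all add: char_def Re_exp Im_exp)
  qed
  show "z = char P \<xi> - char N \<xi>"
    using integral_decomposition_unique[OF assms z(1), of "\<lambda>y. cos (\<xi> * y)"]
      integral_decomposition_unique[OF assms z(1), of "\<lambda>y. sin (\<xi> * y)"] assms z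
    by (intro complex_eqI) (simp_all add: c signed_decomposition_def)
qed (use assms in blast)

lemma
  fixes w a :: "nat \<Rightarrow> real"
  assumes w: "\<And>i. 0 \<le> w i"
  shows finite_weighted_diracs: "finite_measure (weighted_diracs borel n w a)"
    and measure_weighted_diracs:
      "B \<in> sets borel \<Longrightarrow> measure (weighted_diracs borel n w a) B = (\<Sum>i<n. w i * indicator B (a i))"
    and char_weighted_diracs:
      "char (weighted_diracs borel n w a) \<xi> = (\<Sum>i<n. w i * iexp (\<xi> * a i))"
proof -
  let ?M = "weighted_diracs borel n w a" and ?P = "point_measure {..<n} (\<lambda>i. ennreal (w i))"
  have a[measurable]: "a \<in> measurable ?P borel"
    by (simp add: measurable_point_measure_eq1)
  have em: "emeasure ?M B = ennreal (\<Sum>i<n. w i * indicator B (a i))" if "B \<in> sets borel" for B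
  proof -
    have "emeasure ?M B = emeasure ?P (a -` B \<inter> {..<n})"
      unfolding weighted_diracs_def using that by (simp add: emeasure_distr a space_point_measure)
    also have "\<dots> = (\<Sum>i\<in>a -` B \<inter> {..<n}. ennreal (w i))"
      by (simp add: emeasure_point_measure_finite)
    also have "\<dots> = ennreal (\<Sum>i\<in>a -` B \<inter> {..<n}. w i)"
      using w by simp
    also have "(\<Sum>i\<in>a -` B \<inter> {..<n}. w i) = (\<Sum>i<n. w i * indicator B (a i))"
      by (intro sum.mono_neutral_cong_left) (auto simp: indicator_def)
    finally show ?thesis .
  qed
  show "finite_measure ?M"
    by (rule finite_measureI) (use em[of UNIV] in \<open>simp add: weighted_diracs_def\<close>)
  show "measure ?M B = (\<Sum>i<n. w i * indicator B (a i))" if "B \<in> sets borel"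
    using em[OF that] w by (simp add: measure_def sum_nonneg)
  show "char ?M \<xi> = (\<Sum>i<n. w i * iexp (\<xi> * a i))"
    unfolding char_def weighted_diracs_def
    by (simp add: integral_distr a lebesgue_integral_point_measure_finite w scaleR_conv_of_real)
qed

lemma fourier_coarse_error:
  "fourier (coarse_error p x u v t) \<xi> =
     (\<Sum>k<num_intervals u. block_error p x u v t k * iexp (\<xi> * x (u ! k)))"
proof -
  let ?d = "block_error p x u v t"
  let ?M = "\<lambda>w. weighted_diracs borel (num_intervals u) w (\<lambda>k. x (u ! k))"
  have d: "max (?d k) 0 - max (- ?d k) 0 = ?d k" for k by simp
  have "signed_decomposition (coarse_error p x u v t)
          (?M (\<lambda>k. max (?d k) 0)) (?M (\<lambda>k. max (- ?d k) 0))"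
    unfolding signed_decomposition_def coarse_error_def
    by (auto simp: finite_weighted_diracs measure_weighted_diracs d
        simp flip: sum_subtractf left_diff_distrib) (simp_all add: weighted_diracs_def)
  then show ?thesis
    by (simp add: fourier_eqI char_weighted_diracs d
        flip: sum_subtractf left_diff_distrib of_real_diff)
qed

end

theory Submission
  imports Defs
begin

text \<open>
  Each of the five statements is equivalent to the convergence, for every \<open>t\<close>, of the stopped power
  sums \<open>S\<^sub>n(t) = \<Sum>\<^sub>i |x(t\<^sub>i\<^sub>+\<^sub>1 \<and> t) - x(t\<^sub>i \<and> t)|\<^sup>p\<close> along \<open>\<pi>\<close> to \<open>\<mu>([0,t])\<close>, where \<open>\<mu>\<close> is the limit measure
  along \<open>\<rho>\<close>. Up to one term, bounded by a power of the oscillation of \<open>x\<close>, \<open>S\<^sub>n\<close> is the distribution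
  function of the discrete variation measure; as \<open>\<mu>\<close> has no atoms, convergence of the distribution
  functions is the same as weak convergence, which takes care of (ii) and (iii).

  A block increment differs from the increment of \<open>x\<close> over the coarse interval by at most twice the
  oscillation at the scale of the fine mesh, so alignment makes the two families close in \<open>\<ell>\<^sup>p\<close>. Hence
  the block errors sum up to the difference of the power sums along \<open>\<pi>\<close> and \<open>\<rho>\<close>, asymptotically, also
  when they are weighted by a continuous function such as \<open>s \<mapsto> exp(i \<xi> x(s))\<close>; (i) is recovered
  from the Fourier transform at \<open>\<xi> = 0\<close>.
\<close>

section \<open>Elementary estimates for sums of p-th powers\<close>

lemma integral_weighted_diracs:
  fixes f :: "'a \<Rightarrow> real"
  assumes "f \<in> borel_measurable S" "\<And>i. i < N \<Longrightarrow> a i \<in> space S" "\<And>i. 0 \<le> w i"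
  shows "(\<integral>y. f y \<partial>weighted_diracs S N w a) = (\<Sum>i<N. w i * f (a i))"
proof -
  have "a \<in> measurable (point_measure {..<N} (\<lambda>i. ennreal (w i))) S"
    using assms(2) by (simp add: measurable_point_measure_eq1)
  then show ?thesis
    using assms unfolding weighted_diracs_def
    by (simp add: integral_distr lebesgue_integral_point_measure_finite)
qed

text \<open>Two regimes. If \<open>b\<close> is close to \<open>a\<close> relative to
  \<open>\<bar>a\<bar>\<close>, then \<open>\<bar>b\<bar> = \<bar>a\<bar> * (1 + h)\<close> with
  small \<open>h\<close>, and continuity of \<open>(1 + h) powr p\<close> at 0 yields the
  \<open>e\<close> term. Otherwise \<open>\<bar>a - b\<bar>\<close> controls both
  \<open>\<bar>a\<bar>\<close> and \<open>\<bar>b\<bar>\<close>, which yields the \<open>K\<close>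
  term.\<close>

lemma abs_powr_diff_le:
  fixes p e :: real
  assumes p: "p > 0" and e: "e > 0"
  obtains K where "K \<ge> 0"
    "\<And>a b :: real. \<bar>\<bar>a\<bar> powr p - \<bar>b\<bar> powr p\<bar> \<le> e * \<bar>a\<bar> powr p + K * \<bar>a - b\<bar> powr p"
proof -
  have "((\<lambda>h::real. (1 + h) powr p) \<longlongrightarrow> (1 + 0) powr p) (nhds 0)"
    by (intro tendsto_intros filterlim_ident) auto
  then have "\<forall>\<^sub>F h in nhds (0::real). dist ((1 + h) powr p) 1 < e"
    using tendstoD e by fastforce
  then obtain d where d: "d > 0" "\<And>h::real. \<bar>h\<bar> < d \<Longrightarrow> \<bar>(1 + h) powr p - 1\<bar> < e"
    by (auto simp: eventually_nhds_metric dist_real_def)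
  \<comment> \<open>The threshold between the regimes: \<open>c < d\<close> lets the continuity
    estimate apply, and beyond it \<open>\<bar>a\<bar> \<le> \<bar>a - b\<bar> / c\<close>, whence
    the constant \<open>(1 + 1 / c) powr p\<close>.\<close>
  define c where "c = min (d / 2) (1 / 2)"
  have c: "c > 0" "c < d" "c < 1" using d(1) by (auto simp: c_def)
  show ?thesis
  proof (rule that[of "(1 + 1 / c) powr p"])
    fix a b :: real
    show "\<bar>\<bar>a\<bar> powr p - \<bar>b\<bar> powr p\<bar> \<le> e * \<bar>a\<bar> powr p + (1 + 1 / c) powr p * \<bar>a - b\<bar> powr p"
    proof (cases "\<bar>a - b\<bar> \<le> c * \<bar>a\<bar>")
      case True
      have "\<bar>\<bar>a\<bar> powr p - \<bar>b\<bar> powr p\<bar> \<le> e * \<bar>a\<bar> powr p"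
      proof (cases "a = 0")
        case False
        define h where "h = (\<bar>b\<bar> - \<bar>a\<bar>) / \<bar>a\<bar>"
        have "\<bar>\<bar>b\<bar> - \<bar>a\<bar>\<bar> \<le> c * \<bar>a\<bar>" using True by linarith
        then have h: "\<bar>h\<bar> \<le> c"
          using False by (simp add: h_def abs_divide divide_le_eq)
        have b: "\<bar>b\<bar> = \<bar>a\<bar> * (1 + h)" using False by (simp add: h_def field_simps)
        have "\<bar>b\<bar> powr p = \<bar>a\<bar> powr p * (1 + h) powr p"
          unfolding b by (rule powr_mult)
        then have "\<bar>\<bar>a\<bar> powr p - \<bar>b\<bar> powr p\<bar> = \<bar>\<bar>a\<bar> powr p * ((1 + h) powr p - 1)\<bar>"
          by (simp add: algebra_simps abs_minus_commute)
        also have "\<dots> = \<bar>a\<bar> powr p * \<bar>(1 + h) powr p - 1\<bar>"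
          by (simp add: abs_mult)
        also have "\<dots> \<le> \<bar>a\<bar> powr p * e"
          using d(2)[of h] h c by (intro mult_left_mono) auto
        finally show ?thesis by (simp add: mult.commute)
      qed (use True in simp)
      then show ?thesis by (smt (verit) mult_nonneg_nonneg powr_ge_zero)
    next
      case False
      have a: "\<bar>a\<bar> \<le> 1 / c * \<bar>a - b\<bar>" using False c by (simp add: field_simps)
      have b: "\<bar>b\<bar> \<le> (1 + 1 / c) * \<bar>a - b\<bar>" using a by (simp add: algebra_simps)
      have "\<bar>a\<bar> \<le> (1 + 1 / c) * \<bar>a - b\<bar>" using a by (simp add: algebra_simps)
      then have "\<bar>a\<bar> powr p \<le> ((1 + 1 / c) * \<bar>a - b\<bar>) powr p"
        "\<bar>b\<bar> powr p \<le> ((1 + 1 / c) * \<bar>a - b\<bar>) powr p"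
        using b p by (auto intro!: powr_mono2)
      moreover have "((1 + 1 / c) * \<bar>a - b\<bar>) powr p = (1 + 1 / c) powr p * \<bar>a - b\<bar> powr p"
        by (rule powr_mult)
      moreover have "0 \<le> \<bar>a\<bar> powr p" "0 \<le> \<bar>b\<bar> powr p" "0 \<le> e * \<bar>a\<bar> powr p" using e by auto
      ultimately show ?thesis by linarith
    qed
  qed simp
qed

text \<open>The null sequence \<open>g\<close> may depend on \<open>e\<close>, as it does when a
  constant or a step approximation is chosen after \<open>e\<close>.\<close>

lemma tendsto_0_if_le_arbitrarily:
  fixes f :: "nat \<Rightarrow> real"
  assumes "\<And>e. e > 0 \<Longrightarrow> \<exists>g. g \<longlonglongrightarrow> 0 \<and> (\<forall>\<^sub>F n in sequentially. \<bar>f n\<bar> \<le> e + g n)"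
  shows "f \<longlonglongrightarrow> 0"
proof (rule tendstoI)
  fix e :: real assume e: "e > 0"
  then obtain g where g: "g \<longlonglongrightarrow> 0" "\<forall>\<^sub>F n in sequentially. \<bar>f n\<bar> \<le> e / 2 + g n"
    using assms[of "e / 2"] by auto
  have "\<forall>\<^sub>F n in sequentially. g n < e / 2"
    using order_tendstoD(2)[OF g(1), of "e / 2"] e by simp
  with g(2) show "\<forall>\<^sub>F n in sequentially. dist (f n) 0 < e"
    by eventually_elim auto
qed

text \<open>The \<open>\<epsilon>\<close>-weighted pointwise bound takes the place of Minkowski's and Hoelder's inequalities.\<close>

lemma sum_abs_powr_diff_tendsto_0:
  fixes a b :: "nat \<Rightarrow> nat \<Rightarrow> real"
  assumes p: "p > 0" and B: "Bseq (\<lambda>n. \<Sum>k<N n. \<bar>a n k\<bar> powr p)"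
    and d: "(\<lambda>n. \<Sum>k<N n. \<bar>a n k - b n k\<bar> powr p) \<longlonglongrightarrow> 0"
  shows "(\<lambda>n. \<Sum>k<N n. \<bar>\<bar>a n k\<bar> powr p - \<bar>b n k\<bar> powr p\<bar>) \<longlonglongrightarrow> 0"
proof (rule tendsto_0_if_le_arbitrarily)
  fix e :: real assume e: "e > 0"
  obtain C where C: "C > 0" "\<And>n. \<bar>\<Sum>k<N n. \<bar>a n k\<bar> powr p\<bar> \<le> C"
    using B by (auto simp: Bseq_def)
  \<comment> \<open>Dividing by the bound \<open>C\<close> of the p-sums makes the \<open>e\<close>
    terms add up to at most \<open>e\<close>.\<close>
  obtain K where K: "K \<ge> 0" "\<And>a b :: real. \<bar>\<bar>a\<bar> powr p - \<bar>b\<bar> powr p\<bar> \<le>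
      e / C * \<bar>a\<bar> powr p + K * \<bar>a - b\<bar> powr p"
    using abs_powr_diff_le[of p "e / C"] e C p by auto
  have "(\<Sum>k<N n. \<bar>\<bar>a n k\<bar> powr p - \<bar>b n k\<bar> powr p\<bar>)
      \<le> e + K * (\<Sum>k<N n. \<bar>a n k - b n k\<bar> powr p)" for n
  proof -
    have "(\<Sum>k<N n. \<bar>\<bar>a n k\<bar> powr p - \<bar>b n k\<bar> powr p\<bar>)
        \<le> e / C * (\<Sum>k<N n. \<bar>a n k\<bar> powr p) + K * (\<Sum>k<N n. \<bar>a n k - b n k\<bar> powr p)"
      using sum_mono[OF K(2)] by (simp add: sum.distrib sum_distrib_left)
    also have "e / C * (\<Sum>k<N n. \<bar>a n k\<bar> powr p) \<le> e / C * C"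
      using C(2)[of n] e C(1) by (intro mult_left_mono) auto
    finally show ?thesis using C(1) by simp
  qed
  then show "\<exists>g. g \<longlonglongrightarrow> 0 \<and> (\<forall>\<^sub>F n in sequentially.
      \<bar>\<Sum>k<N n. \<bar>\<bar>a n k\<bar> powr p - \<bar>b n k\<bar> powr p\<bar>\<bar> \<le> e + g n)"
    using tendsto_mult_right_zero[OF d, of K]
    by (intro exI[of _ "\<lambda>n. K * (\<Sum>k<N n. \<bar>a n k - b n k\<bar> powr p)"]) auto
qed

lemma sum_single_index_le:
  fixes f :: "'a \<Rightarrow> real"
  assumes "finite A" and B: "0 \<le> B" "\<And>i. i \<in> A \<Longrightarrow> \<bar>f i\<bar> \<le> B"
    and u: "\<And>i j. i \<in> A \<Longrightarrow> j \<in> A \<Longrightarrow> f i \<noteq> 0 \<Longrightarrow> f j \<noteq> 0 \<Longrightarrow> i = j"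
  shows "\<bar>sum f A\<bar> \<le> B"
proof (cases "\<exists>i\<in>A. f i \<noteq> 0")
  case True
  then obtain i where i: "i \<in> A" "f i \<noteq> 0" by auto
  have "sum f A = sum f {i}"
    using i u assms(1) by (intro sum.mono_neutral_right) auto
  then show ?thesis using i B by simp
qed (use B in simp)

lemma continuous_on_Icc_uniformE:
  fixes f :: "real \<Rightarrow> real"
  assumes "continuous_on {a..b} f" "e > 0"
  obtains d where "d > 0" "\<And>s t. s \<in> {a..b} \<Longrightarrow> t \<in> {a..b} \<Longrightarrow> \<bar>s - t\<bar> < d \<Longrightarrow> \<bar>f s - f t\<bar> < e"
  using compact_uniformly_continuous[OF assms(1) compact_Icc] assms(2)
  unfolding uniformly_continuous_on_def dist_real_def by (metis)

section \<open>Weak convergence of discrete measures on an interval\<close>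

lemma finite_measure_Icc_integrable:
  fixes f :: "real \<Rightarrow> real"
  assumes s: "sets \<mu> = sets (restrict_space borel {0..T})" and "finite_measure \<mu>"
    and f: "continuous_on {0..T} f"
  shows "integrable \<mu> f"
proof -
  interpret finite_measure \<mu> by fact
  have sp: "space \<mu> = {0..T}" using sets_eq_imp_space_eq[OF s] by (simp add: space_restrict_space)
  have "f \<in> borel_measurable \<mu>"
    unfolding measurable_cong_sets[OF s refl] by (rule borel_measurable_continuous_on_restrict[OF f])
  moreover obtain B where "\<And>y. y \<in> {0..T} \<Longrightarrow> norm (f y) \<le> B"
    using compact_continuous_image[OF f compact_Icc, THEN compact_imp_bounded]
    by (force simp: bounded_iff)
  ultimately show ?thesis by (intro integrable_const_bound[where B=B]) (auto simp: sp)
qed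

lemma Icc_sets:
  assumes s: "sets \<mu> = sets (restrict_space borel {0..T})"
  shows "space \<mu> = {0..T}" "\<And>t. t \<in> {0..T} \<Longrightarrow> {0..t} \<in> sets \<mu>"
    "\<And>t. t \<in> {0..T::real} \<Longrightarrow> {t} \<in> sets \<mu>"
proof -
  show "space \<mu> = {0..T}" using sets_eq_imp_space_eq[OF s] by (simp add: space_restrict_space)
  show "{0..t} \<in> sets \<mu>" "{t} \<in> sets \<mu>" if "t \<in> {0..T}" for t
    unfolding s using that by (auto simp: sets_restrict_space_iff)
qed

text \<open>The coefficients \<open>f \<tau>\<^sub>k - f \<tau>\<^bsub>k+1\<^esub>\<close> with \<open>\<tau>\<^sub>k \<ge> y\<close> telescope to \<open>f\<close> at the first grid point above \<open>y\<close>.\<close>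

lemma step_approx:
  fixes f :: "real \<Rightarrow> real"
  assumes f: "continuous_on {0..T} f" and T: "0 \<le> T" and e: "e > 0"
  obtains m :: nat and c \<tau> :: "nat \<Rightarrow> real" where "\<And>k. k < m \<Longrightarrow> \<tau> k \<in> {0..T}"
    "\<And>y. y \<in> {0..T} \<Longrightarrow> \<bar>f y - (\<Sum>k<m. c k * indicator {0..\<tau> k} y)\<bar> \<le> e"
proof -
  obtain d where d: "d > 0" "\<And>s t. s \<in> {0..T} \<Longrightarrow> t \<in> {0..T} \<Longrightarrow> \<bar>s - t\<bar> < d \<Longrightarrow> \<bar>f s - f t\<bar> < e"
    using continuous_on_Icc_uniformE[OF f e] by metis
  obtain m where *: "T / d < real m" using reals_Archimedean2 by blast
  moreover have "0 \<le> T / d" using T d(1) by simp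
  ultimately have "m > 0" by linarith
  with * d(1) have m: "m > 0" "T / real m < d" by (auto simp: field_simps)
  define \<tau> where "\<tau> k = real k * T / real m" for k
  have \<tau>: "\<tau> k \<in> {0..T}" if "k \<le> m" for k
    using that m T by (auto simp: \<tau>_def field_simps intro: mult_left_mono)
  \<comment> \<open>The last coefficient is \<open>f T\<close> itself, so that the telescoping sum
    from \<open>k\<close> to \<open>m\<close> leaves \<open>f (\<tau> k)\<close>.\<close>
  define c where "c k = (if k = m then f T else f (\<tau> k) - f (\<tau> (Suc k)))" for k
  have \<tau>m: "\<tau> m = T" using m by (simp add: \<tau>_def)
  have \<tau>_mono: "\<tau> i \<le> \<tau> j" if "i \<le> j" for i j
    using that T by (auto simp: \<tau>_def intro!: divide_right_mono mult_right_mono)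
  show ?thesis
  proof (rule that[of "Suc m" \<tau> c])
    fix y assume y: "y \<in> {0..T}"
    \<comment> \<open>The first grid point not below \<open>y\<close>: the indicator of
      \<open>{0..\<tau> j}\<close> is 1 at \<open>y\<close> exactly for
      \<open>j \<ge> k\<close>.\<close>
    define k where "k = (LEAST k. y \<le> \<tau> k)"
    have "y \<le> \<tau> m" using y \<tau>m by simp
    then have k: "y \<le> \<tau> k" "k \<le> m"
      unfolding k_def by (auto intro: LeastI Least_le)
    have less: "\<tau> j < y" if "j < k" for j
      using not_less_Least[of j "\<lambda>k. y \<le> \<tau> k"] that by (simp add: k_def)
    have "(\<Sum>j<Suc m. c j * indicator {0..\<tau> j} y) = (\<Sum>j\<in>{k..m}. c j)"
    proof (rule sum.mono_neutral_cong_right)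
      show "\<forall>i\<in>{..<Suc m} - {k..m}. c i * indicator {0..\<tau> i} y = 0"
      proof
        fix i assume "i \<in> {..<Suc m} - {k..m}"
        then have "\<tau> i < y" by (intro less) auto
        then show "c i * indicator {0..\<tau> i} y = 0" by simp
      qed
      show "c j * indicator {0..\<tau> j} y = c j" if "j \<in> {k..m}" for j
        using that k(1) \<tau>_mono[of k j] y by auto
    qed auto
    also have "\<dots> = (\<Sum>j\<in>{k..<m}. f (\<tau> j) - f (\<tau> (Suc j))) + f T"
    proof -
      have "{k..m} = insert m {k..<m}" using k by auto
      then show ?thesis by (simp add: c_def)
    qed
    also have "\<dots> = f (\<tau> k)"
      using sum_Suc_diff'[OF k(2), of "\<lambda>j. - f (\<tau> j)"] by (simp add: \<tau>m)
    finally have eq: "(\<Sum>j<Suc m. c j * indicator {0..\<tau> j} y) = f (\<tau> k)" .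
    \<comment> \<open>For \<open>k = 0\<close> the point \<open>y\<close> equals
      \<open>\<tau> 0 = 0\<close>; otherwise it lies in the grid interval ending at
      \<open>\<tau> k\<close>, of length \<open>T / m < d\<close>.\<close>
    have "\<bar>y - \<tau> k\<bar> < d"
    proof (cases k)
      case 0
      then show ?thesis using k(1) y d(1) by (simp add: \<tau>_def)
    next
      case (Suc j)
      then have "\<tau> k = \<tau> j + T / real m" by (simp add: \<tau>_def distrib_right add_divide_distrib)
      then show ?thesis using less[of j] Suc k(1) m(2) by simp
    qed
    then show "\<bar>f y - (\<Sum>k<Suc m. c k * indicator {0..\<tau> k} y)\<bar> \<le> e"
      unfolding eq using d(2)[OF y \<tau>] k by (meson less_imp_le)
  qed (use \<tau> in auto)
qed

text \<open>For a step function from \<open>step_approx\<close> the integrals are finite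
  combinations of values of the distribution functions, hence converge. The uniform error of the
  approximation is multiplied by total masses, which converge by the case
  \<open>t = T\<close>.\<close>

lemma integral_tendsto_of_cdf_tendsto:
  fixes w a :: "nat \<Rightarrow> nat \<Rightarrow> real" and f :: "real \<Rightarrow> real"
  assumes s: "sets \<mu> = sets (restrict_space borel {0..T})" and fin: "finite_measure \<mu>"
    and T: "0 \<le> T" and w: "\<And>n i. 0 \<le> w n i" and a: "\<And>n i. i < N n \<Longrightarrow> a n i \<in> {0..T}"
    and cdf: "\<And>t. t \<in> {0..T} \<Longrightarrow>
      (\<lambda>n. \<Sum>i<N n. w n i * indicator {0..t} (a n i)) \<longlonglongrightarrow> measure \<mu> {0..t}"
    and f: "continuous_on {0..T} f"
  shows "(\<lambda>n. \<Sum>i<N n. w n i * f (a n i)) \<longlonglongrightarrow> (\<integral>y. f y \<partial>\<mu>)"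
proof -
  interpret finite_measure \<mu> by fact
  note sp = Icc_sets[OF s]
  define W where "W n = (\<Sum>i<N n. w n i)" for n
  define C where "C = measure \<mu> {0..T}"
  have W: "W \<longlonglongrightarrow> C"
  proof -
    have "W = (\<lambda>n. \<Sum>i<N n. w n i * indicator {0..T} (a n i))"
      using a by (auto simp: W_def indicator_def intro!: sum.cong)
    then show ?thesis using cdf[of T] T by (simp add: C_def)
  qed
  have C: "C \<ge> 0" by (simp add: C_def)
  have "(\<lambda>n. (\<Sum>i<N n. w n i * f (a n i)) - (\<integral>y. f y \<partial>\<mu>)) \<longlonglongrightarrow> 0"
  proof (rule tendsto_0_if_le_arbitrarily)
    fix e :: real assume e: "e > 0"
    \<comment> \<open>Eventually the discrete mass is below \<open>C + 1\<close>, so the two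
      approximation errors are at most \<open>e' * (C + 1)\<close> and \<open>e' * C\<close>,
      together \<open>e\<close>.\<close>
    define e' where "e' = e / (2 * C + 1)"
    have e': "e' > 0" "e' * (2 * C + 1) = e" using e C by (auto simp: e'_def)
    obtain m :: nat and c \<tau> :: "nat \<Rightarrow> real" where \<tau>: "\<And>k. k < m \<Longrightarrow> \<tau> k \<in> {0..T}" and
      g': "\<And>y. y \<in> {0..T} \<Longrightarrow> \<bar>f y - (\<Sum>k<m. c k * indicator {0..\<tau> k} y)\<bar> \<le> e'"
      using step_approx[OF f T e'(1)] by metis
    define g where "g y = (\<Sum>k<m. c k * indicator {0..\<tau> k} y)" for y
    have g: "\<bar>f y - g y\<bar> \<le> e'" if "y \<in> {0..T}" for y using g'[OF that] by (simp add: g_def)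
    have ind: "integrable \<mu> (\<lambda>y. c k * indicator {0..\<tau> k} y)" if "k < m" for k
      using sp(2)[OF \<tau>[OF that]] by (intro integrable_mult_right integrable_real_indicator)
        (auto simp: less_top[symmetric])
    have gi: "integrable \<mu> g" unfolding g_def by (rule Bochner_Integration.integrable_sum) (use ind in auto)
    have "(\<integral>y. g y \<partial>\<mu>) = (\<Sum>k<m. c k * measure \<mu> {0..\<tau> k})"
    proof -
      have "(\<integral>y. g y \<partial>\<mu>) = (\<Sum>k<m. \<integral>y. c k * indicator {0..\<tau> k} y \<partial>\<mu>)"
        unfolding g_def by (rule Bochner_Integration.integral_sum) (use ind in auto)
      also have "\<dots> = (\<Sum>k<m. c k * measure \<mu> {0..\<tau> k})"
        using sp(2)[OF \<tau>] by (intro sum.cong) (auto simp: sets.Int_space_eq2)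
      finally show ?thesis .
    qed
    moreover have "(\<Sum>i<N n. w n i * g (a n i)) =
        (\<Sum>k<m. c k * (\<Sum>i<N n. w n i * indicator {0..\<tau> k} (a n i)))" for n
      unfolding g_def sum_distrib_left by (subst sum.swap) (simp add: mult_ac)
    ultimately have lim: "(\<lambda>n. \<Sum>i<N n. w n i * g (a n i)) \<longlonglongrightarrow> (\<integral>y. g y \<partial>\<mu>)"
      using \<tau> by (simp only:) (intro tendsto_sum tendsto_mult_left cdf, simp)
    define h where "h n = \<bar>(\<Sum>i<N n. w n i * g (a n i)) - (\<integral>y. g y \<partial>\<mu>)\<bar>" for n
    have h: "h \<longlonglongrightarrow> 0" unfolding h_def
      using tendsto_rabs[OF LIM_zero[OF lim]] by simp
    have 1: "\<bar>(\<Sum>i<N n. w n i * f (a n i)) - (\<Sum>i<N n. w n i * g (a n i))\<bar> \<le> e' * W n" for n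
    proof -
      have "(\<Sum>i<N n. w n i * f (a n i)) - (\<Sum>i<N n. w n i * g (a n i)) =
          (\<Sum>i<N n. w n i * (f (a n i) - g (a n i)))"
        by (simp add: sum_subtractf right_diff_distrib)
      also have "\<bar>\<dots>\<bar> \<le> (\<Sum>i<N n. w n i * e')"
        using g a w by (intro order_trans[OF sum_abs] sum_mono) (auto simp: abs_mult intro!: mult_left_mono)
      finally show ?thesis by (simp add: W_def sum_distrib_left mult.commute)
    qed
    have 2: "\<bar>(\<integral>y. f y \<partial>\<mu>) - (\<integral>y. g y \<partial>\<mu>)\<bar> \<le> e' * C"
    proof -
      have fi: "integrable \<mu> f" by (rule finite_measure_Icc_integrable[OF s fin f])
      have "(\<integral>y. f y \<partial>\<mu>) - (\<integral>y. g y \<partial>\<mu>) = (\<integral>y. f y - g y \<partial>\<mu>)"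
        using fi gi by simp
      also have "\<bar>\<dots>\<bar> \<le> (\<integral>y. \<bar>f y - g y\<bar> \<partial>\<mu>)" by (rule integral_abs_bound)
      also have "\<dots> \<le> (\<integral>y. e' \<partial>\<mu>)"
        using fi gi g by (intro integral_mono) (auto simp: sp)
      finally show ?thesis by (simp add: C_def sp mult.commute)
    qed
    have "\<forall>\<^sub>F n in sequentially. W n < C + 1"
      using order_tendstoD(2)[OF W, of "C + 1"] by simp
    then have "\<forall>\<^sub>F n in sequentially.
        \<bar>(\<Sum>i<N n. w n i * f (a n i)) - (\<integral>y. f y \<partial>\<mu>)\<bar> \<le> e + h n"
    proof eventually_elim
      case (elim n)
      have "e' * W n \<le> e' * (C + 1)" using elim e' by (intro mult_left_mono) auto
      then have "e' * W n + e' * C \<le> e" using e'(2) by (simp add: algebra_simps)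
      then show ?case using 1[of n] 2 unfolding h_def by linarith
    qed
    then show "\<exists>g. g \<longlonglongrightarrow> 0 \<and> (\<forall>\<^sub>F n in sequentially.
        \<bar>(\<Sum>i<N n. w n i * f (a n i)) - (\<integral>y. f y \<partial>\<mu>)\<bar> \<le> e + g n)"
      using h by blast
  qed
  then show ?thesis by (rule LIM_zero_cancel)
qed

text \<open>The only subsets of \<open>{t}\<close> are \<open>{}\<close> and \<open>{t}\<close>, and
  neither has measure strictly between 0 and that of \<open>{t}\<close>.\<close>

lemma nonatomic_singleton:
  assumes "nonatomic \<mu>" "{t} \<in> sets \<mu>"
  shows "emeasure \<mu> {t} = 0"
  using assms unfolding nonatomic_def
  by (metis emeasure_empty less_irrefl subset_singletonD not_gr_zero)

text \<open>A portmanteau argument: the indicator of \<open>{0..t}\<close> is squeezed between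
  continuous ramps whose integrals both approach \<open>measure \<mu> {0..t}\<close>, since
  \<open>{t}\<close> is a null set.\<close>

lemma cdf_tendsto_of_integral_tendsto:
  fixes w a :: "nat \<Rightarrow> nat \<Rightarrow> real"
  assumes s: "sets \<mu> = sets (restrict_space borel {0..T})" and fin: "finite_measure \<mu>"
    and na: "nonatomic \<mu>" and w: "\<And>n i. 0 \<le> w n i" and a: "\<And>n i. i < N n \<Longrightarrow> a n i \<in> {0..T}"
    and int: "\<And>f :: real \<Rightarrow> real. continuous_on {0..T} f \<Longrightarrow>
      (\<lambda>n. \<Sum>i<N n. w n i * f (a n i)) \<longlonglongrightarrow> (\<integral>y. f y \<partial>\<mu>)"
    and t: "t \<in> {0..T}"
  shows "(\<lambda>n. \<Sum>i<N n. w n i * indicator {0..t} (a n i)) \<longlonglongrightarrow> measure \<mu> {0..t}"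
proof -
  interpret finite_measure \<mu> by fact
  note sp = Icc_sets[OF s]
  \<comment> \<open>The ramp takes the value \<open>b\<close> at \<open>t\<close>, falls with slope
    \<open>-(k + 1)\<close> and is clipped to \<open>[0,1]\<close>. On \<open>[0,T]\<close> it lies
    below the indicator for \<open>b = 0\<close> and above it for \<open>b = 1\<close>.\<close>
  define r where "r b k y = max 0 (min 1 (b - (real k + 1) * (y - t)))" for b :: real and k y
  have cont: "continuous_on A (r b k)" for A b k
    unfolding r_def by (intro continuous_intros)
  have lim: "(\<lambda>k. r b k y) \<longlonglongrightarrow> (if y < t then 1 else if y = t then b else 0)"
    if "b \<in> {0..1}" for b y
  proof (cases "y = t")
    case False
    \<comment> \<open>Away from \<open>t\<close> the ramp is saturated at 0 or 1 as soon as
      \<open>(k + 1) * \<bar>y - t\<bar> \<ge> 1\<close>.\<close>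
    have inf: "filterlim (\<lambda>k. (real k + 1) * \<bar>y - t\<bar>) at_top sequentially"
      using False by real_asymp
    then have "\<forall>\<^sub>F k in sequentially. (real k + 1) * \<bar>y - t\<bar> \<ge> 1"
      by (simp add: filterlim_at_top)
    then have "\<forall>\<^sub>F k in sequentially. r b k y = (if y < t then 1 else if y = t then b else 0)"
    proof eventually_elim
      case (elim k)
      show ?case
      proof (cases "y < t")
        case True
        then have "(real k + 1) * (y - t) = - ((real k + 1) * \<bar>y - t\<bar>)" by (simp add: algebra_simps)
        with elim True that show ?thesis by (simp add: r_def)
      next
        case F: False
        then show ?thesis using elim False that by (simp add: r_def)
      qed
    qed
    then show ?thesis by (rule tendsto_eventually)
  qed (use that in \<open>simp add: r_def\<close>)
  have rlim: "(\<lambda>k. \<integral>y. r b k y \<partial>\<mu>) \<longlonglongrightarrow> measure \<mu> {0..t}" if b: "b \<in> {0..1}" for b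
  proof -
    \<comment> \<open>The pointwise limit of the ramps can differ from the indicator only at
      \<open>t\<close>.\<close>
    have "AE y in \<mu>. y \<notin> {t}"
      using nonatomic_singleton[OF na sp(3)[OF t]] sp(3)[OF t] by (intro AE_not_in) auto
    then have "AE y in \<mu>. (\<lambda>k. r b k y) \<longlonglongrightarrow> indicator {0..t} y"
      using AE_space
    proof eventually_elim
      case (elim y)
      then show ?case using lim[OF b, of y] by (auto simp: sp indicator_def split: if_splits)
    qed
    then have "(\<lambda>k. \<integral>y. r b k y \<partial>\<mu>) \<longlonglongrightarrow> (\<integral>y. indicator {0..t} y \<partial>\<mu>)"
    proof (rule integral_dominated_convergence[where w="\<lambda>_. 1", rotated 3])
      show "r b k \<in> borel_measurable \<mu>" for k
        unfolding measurable_cong_sets[OF s refl]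
        by (intro borel_measurable_continuous_on_restrict cont)
      show "indicator {0..t} \<in> borel_measurable \<mu>"
        using sp(2)[OF t] by (rule borel_measurable_indicator)
      show "AE y in \<mu>. norm (r b k y) \<le> 1" for k by (auto simp: r_def)
    qed simp
    then show ?thesis using sp(2)[OF t] by (simp add: sets.Int_space_eq2)
  qed
  have bounds: "(\<Sum>i<N n. w n i * r 0 k (a n i)) \<le> (\<Sum>i<N n. w n i * indicator {0..t} (a n i))"
    "(\<Sum>i<N n. w n i * indicator {0..t} (a n i)) \<le> (\<Sum>i<N n. w n i * r 1 k (a n i))" for n k
  proof -
    have "r 0 k y \<le> indicator {0..t} y" "indicator {0..t} y \<le> r 1 k y" if "y \<in> {0..T}" for y
    proof -
      have "(real k + 1) * (y - t) \<ge> 0" if "y \<ge> t" using that by simp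
      moreover have "(real k + 1) * (y - t) \<le> 0" if "y \<le> t"
        using that by (simp add: mult_nonneg_nonpos)
      ultimately show "r 0 k y \<le> indicator {0..t} y" "indicator {0..t} y \<le> r 1 k y"
        using that by (auto simp: r_def indicator_def min_le_iff_disj)
    qed
    then show "(\<Sum>i<N n. w n i * r 0 k (a n i)) \<le> (\<Sum>i<N n. w n i * indicator {0..t} (a n i))"
      "(\<Sum>i<N n. w n i * indicator {0..t} (a n i)) \<le> (\<Sum>i<N n. w n i * r 1 k (a n i))"
      using a w by (intro sum_mono mult_left_mono; simp)+
  qed
  show ?thesis
  proof (rule order_tendstoI)
    \<comment> \<open>Two limits in turn: first fix \<open>k\<close> so that the integral of the
      ramp is already on the right side of \<open>c\<close>, then let \<open>n\<close> grow for this
      continuous ramp.\<close>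
    fix c assume "c < measure \<mu> {0..t}"
    from order_tendstoD(1)[OF rlim[of 0] this]
    obtain k where k: "c < (\<integral>y. r 0 k y \<partial>\<mu>)" by (auto simp: eventually_sequentially)
    from order_tendstoD(1)[OF int[OF cont] this]
    show "\<forall>\<^sub>F n in sequentially. c < (\<Sum>i<N n. w n i * indicator {0..t} (a n i))"
      by eventually_elim (use bounds(1)[of _ k] in \<open>meson less_le_trans\<close>)
  next
    fix c assume "measure \<mu> {0..t} < c"
    from order_tendstoD(2)[OF rlim[of 1] this]
    obtain k where k: "(\<integral>y. r 1 k y \<partial>\<mu>) < c" by (auto simp: eventually_sequentially)
    from order_tendstoD(2)[OF int[OF cont] this]
    show "\<forall>\<^sub>F n in sequentially. (\<Sum>i<N n. w n i * indicator {0..t} (a n i)) < c"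
      by eventually_elim (use bounds(2)[of _ k] in \<open>meson le_less_trans\<close>)
  qed
qed

text \<open>Both measures are pushed forward to the line, where agreement on the half-lines
  \<open>{t<..}\<close> suffices; a measurable set of \<open>\<mu>\<close> is a Borel subset of
  \<open>[0,T]\<close> and is recovered from the push-forward.\<close>

lemma measure_eqI_Icc:
  fixes \<mu> \<mu>' :: "real measure"
  assumes s: "sets \<mu> = sets (restrict_space borel {0..T})" and fin: "finite_measure \<mu>"
    and s': "sets \<mu>' = sets (restrict_space borel {0..T})" and fin': "finite_measure \<mu>'"
    and eq: "\<And>t. t \<in> {0..T} \<Longrightarrow> measure \<mu> {0..t} = measure \<mu>' {0..t}"
    and T: "0 \<le> T"
  shows "\<mu> = \<mu>'"
proof -
  note sp = Icc_sets[OF s] and sp' = Icc_sets[OF s']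
  have m: "(\<lambda>y. y) \<in> borel_measurable \<mu>" "(\<lambda>y. y) \<in> borel_measurable \<mu>'"
    unfolding measurable_cong_sets[OF s refl] measurable_cong_sets[OF s' refl]
    by (auto intro!: measurable_restrict_space1)
  \<comment> \<open>A tail is total mass minus distribution function, with separate values where
    \<open>t\<close> falls outside \<open>[0,T)\<close>.\<close>
  have gr: "emeasure M ({t<..} \<inter> {0..T}) = ennreal (if t < 0 then measure M {0..T}
      else if T \<le> t then 0 else measure M {0..T} - measure M {0..t})"
    if sM: "sets M = sets (restrict_space borel {0..T})" and fM: "finite_measure M" for M t
  proof -
    interpret finite_measure M by fact
    note spM = Icc_sets[OF sM]
    consider "t < 0" | "T \<le> t" | "0 \<le> t" "t < T" by linarith
    then show ?thesis
    proof cases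
      case 1
      then have "{t<..} \<inter> {0..T} = {0..T}" by auto
      with 1 show ?thesis by (simp add: emeasure_eq_measure)
    next
      case 2
      then have "{t<..} \<inter> {0..T} = {}" by auto
      with 2 T show ?thesis by (simp only:) simp
    next
      case 3
      then have "{t<..} \<inter> {0..T} = {0..T} - {0..t}" by auto
      moreover have "measure M ({0..T} - {0..t}) = measure M {0..T} - measure M {0..t}"
        using 3 T spM(2)[of t] spM(2)[of T] by (intro finite_measure_Diff) auto
      ultimately show ?thesis using 3 by (simp add: emeasure_eq_measure)
    qed
  qed
  have "distr \<mu> borel (\<lambda>y. y) = distr \<mu>' borel (\<lambda>y. y)"
  proof (rule measure_eqI_lessThan)
    fix t
    show "emeasure (distr \<mu> borel (\<lambda>y. y)) {t<..} < \<infinity>"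
      using gr[OF s fin] by (simp add: emeasure_distr m sp)
    show "emeasure (distr \<mu> borel (\<lambda>y. y)) {t<..} = emeasure (distr \<mu>' borel (\<lambda>y. y)) {t<..}"
      using gr[OF s fin] gr[OF s' fin'] eq T by (simp add: emeasure_distr m sp sp')
  qed auto
  then have D: "emeasure (distr \<mu> borel (\<lambda>y. y)) A = emeasure (distr \<mu>' borel (\<lambda>y. y)) A" for A
    by simp
  show ?thesis
  proof (rule measure_eqI)
    fix A assume A: "A \<in> sets \<mu>"
    then have "A \<in> sets borel" "A \<subseteq> {0..T}" by (auto simp: s sets_restrict_space_iff)
    then show "emeasure \<mu> A = emeasure \<mu>' A"
      using D[of A] by (simp add: emeasure_distr m sp sp' Int_absorb2)
  qed (simp add: s s')
qed

section \<open>Partitions and oscillation\<close>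

lemma partition_nth:
  assumes u: "is_partition T u" and T: "T > 0"
  shows "0 < num_intervals u" "u ! 0 = 0" "u ! num_intervals u = T"
    and "\<And>i j. i < j \<Longrightarrow> j \<le> num_intervals u \<Longrightarrow> u ! i < u ! j"
    and "\<And>i j. i \<le> j \<Longrightarrow> j \<le> num_intervals u \<Longrightarrow> u ! i \<le> u ! j"
    and "\<And>i. i \<le> num_intervals u \<Longrightarrow> u ! i \<in> {0..T}"
    and "\<And>i. i < num_intervals u \<Longrightarrow> u ! Suc i - u ! i \<le> mesh u"
    and "0 \<le> mesh u"
proof -
  have ne: "u \<noteq> []" and ends: "hd u = 0" "last u = T" and so: "sorted_wrt (<) u"
    using u by (auto simp: is_partition_def)
  show z: "u ! 0 = 0" and l: "u ! num_intervals u = T"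
    using ne ends by (auto simp: hd_conv_nth last_conv_nth num_intervals_def)
  \<comment> \<open>\<open>T > 0\<close> excludes the one-point partition, for which
    \<open>mesh\<close> would be the maximum of an empty set.\<close>
  then show N: "0 < num_intervals u" using T by (intro gr0I) auto
  show less: "u ! i < u ! j" if "i < j" "j \<le> num_intervals u" for i j
    using sorted_wrt_nth_less[OF so that(1)] that(2) N by (simp add: num_intervals_def)
  then show le: "u ! i \<le> u ! j" if "i \<le> j" "j \<le> num_intervals u" for i j
    using that by (cases "i = j") (auto intro: less_imp_le)
  show "u ! i \<in> {0..T}" if "i \<le> num_intervals u" for i
    using le[of 0 i] le[of i "num_intervals u"] that z l by auto
  show m: "u ! Suc i - u ! i \<le> mesh u" if "i < num_intervals u" for i
    unfolding mesh_def using that by (intro Max_ge) auto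
  show "0 \<le> mesh u" using m[of 0] less[of 0 1] N by simp
qed

lemma osc_upper:
  assumes "continuous_on {0..T} x" "s \<in> {0..T}" "t \<in> {0..T}" "\<bar>t - s\<bar> \<le> h"
  shows "\<bar>x t - x s\<bar> \<le> osc T x h"
proof -
  obtain B where B: "\<And>y. y \<in> {0..T} \<Longrightarrow> \<bar>x y\<bar> \<le> B"
    using compact_continuous_image[OF assms(1) compact_Icc, THEN compact_imp_bounded]
    by (force simp: bounded_iff)
  \<comment> \<open>A real \<open>Sup\<close> dominates the elements only of a set bounded above;
    here compactness bounds \<open>x\<close>.\<close>
  have "bdd_above {\<bar>x t - x s\<bar> | s t. s \<in> {0..T} \<and> t \<in> {0..T} \<and> \<bar>t - s\<bar> \<le> h}"
  proof (rule bdd_aboveI)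
    fix z assume "z \<in> {\<bar>x t - x s\<bar> | s t. s \<in> {0..T} \<and> t \<in> {0..T} \<and> \<bar>t - s\<bar> \<le> h}"
    then obtain s t where "z = \<bar>x t - x s\<bar>" "s \<in> {0..T}" "t \<in> {0..T}" by blast
    then show "z \<le> 2 * B" using B[of s] B[of t] by linarith
  qed
  then show ?thesis unfolding osc_def using assms by (intro cSup_upper) auto
qed

lemma osc_nonneg:
  assumes "continuous_on {0..T} x" "0 \<le> T" "0 \<le> h"
  shows "0 \<le> osc T x h"
  using osc_upper[OF assms(1), of 0 0 h] assms by simp

lemma osc_tendsto_0:
  assumes x: "continuous_on {0..T} x" and T: "0 \<le> T" and h: "\<And>n. 0 \<le> h n" "h \<longlonglongrightarrow> 0"
  shows "(\<lambda>n. osc T x (h n)) \<longlonglongrightarrow> 0"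
proof (rule tendstoI)
  fix e :: real assume e: "e > 0"
  \<comment> \<open>Half of \<open>e\<close>, because passing to the supremum leaves only a weak
    inequality.\<close>
  then obtain d where d: "d > 0"
    "\<And>s t. s \<in> {0..T} \<Longrightarrow> t \<in> {0..T} \<Longrightarrow> \<bar>s - t\<bar> < d \<Longrightarrow> \<bar>x s - x t\<bar> < e / 2"
    using continuous_on_Icc_uniformE[OF x, of "e / 2"] by (metis half_gt_zero)
  have "\<forall>\<^sub>F n in sequentially. h n < d" using order_tendstoD(2)[OF h(2) d(1)] .
  then show "\<forall>\<^sub>F n in sequentially. dist (osc T x (h n)) 0 < e"
  proof eventually_elim
    case (elim n)
    have "osc T x (h n) \<le> e / 2" unfolding osc_def
    proof (rule cSup_least)
      show "{\<bar>x t - x s\<bar> | s t. s \<in> {0..T} \<and> t \<in> {0..T} \<and> \<bar>t - s\<bar> \<le> h n} \<noteq> {}"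
        using T h(1)[of n] by (auto intro!: exI[of _ "0::real"])
      fix z assume "z \<in> {\<bar>x t - x s\<bar> | s t. s \<in> {0..T} \<and> t \<in> {0..T} \<and> \<bar>t - s\<bar> \<le> h n}"
      then obtain s t where "z = \<bar>x t - x s\<bar>" "s \<in> {0..T}" "t \<in> {0..T}" "\<bar>t - s\<bar> \<le> h n" by blast
      then show "z \<le> e / 2" using d(2)[of t s] elim by simp
    qed
    then show ?case using osc_nonneg[OF x T h(1)] e by simp
  qed
qed

text \<open>The total mass of \<open>occupation_measure p x u t\<close>; for a partition
  \<open>u\<close> of \<open>[0,T]\<close> and \<open>t = T\<close> also that of
  \<open>variation_measure T p x u\<close>.\<close>

definition pth_sum :: "real \<Rightarrow> (real \<Rightarrow> real) \<Rightarrow> real list \<Rightarrow> real \<Rightarrow> real" where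
  "pth_sum p x u t = (\<Sum>i<num_intervals u. \<bar>increment x u t i\<bar> powr p)"

lemma increment_eq_0: "t \<le> u ! i \<Longrightarrow> u ! i \<le> u ! Suc i \<Longrightarrow> increment x u t i = 0"
  by (simp add: increment_def min_absorb2)

section \<open>Stopped power sums of a continuous path\<close>

locale continuous_path =
  fixes T p :: real and x :: "real \<Rightarrow> real"
  assumes T_pos: "T > 0" and p_pos: "p > 0" and cont: "continuous_on {0..T} x"
begin

lemmas partition = partition_nth[OF _ T_pos]

lemma vanishingD:
  assumes "vanishing_partitions T u"
  shows "is_partition T (u n)" "(\<lambda>n. mesh (u n)) \<longlonglongrightarrow> 0" "0 \<le> mesh (u n)"
  using assms partition(8) by (auto simp: vanishing_partitions_def)

lemma osc_mesh_tendsto_0: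
  assumes u: "vanishing_partitions T u" and g: "continuous_on {0..T} g"
  shows "(\<lambda>n. osc T g (mesh (u n))) \<longlonglongrightarrow> 0"
  using vanishingD[OF u] T_pos by (intro osc_tendsto_0 g) auto

lemma increment_le_osc:
  assumes "is_partition T u" "i < num_intervals u" "t \<in> {0..T}"
  shows "\<bar>increment x u t i\<bar> \<le> osc T x (mesh u)"
  unfolding increment_def
  using partition(6)[OF assms(1), of i] partition(6)[OF assms(1), of "Suc i"]
    partition(7)[OF assms(1,2)] partition(4)[OF assms(1), of i "Suc i"] assms
  by (intro osc_upper[OF cont]) (auto simp: min_def)

text \<open>Only the interval that contains \<open>s\<close> contributes to the difference.\<close>

lemma cdf_diff_pth_sum_le:
  assumes u: "is_partition T u" and s: "0 \<le> s" "s \<le> t" and t: "t \<le> T"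
  shows "\<bar>(\<Sum>i<num_intervals u. \<bar>increment x u t i\<bar> powr p * indicator {0..s} (min (u ! i) t))
    - pth_sum p x u s\<bar> \<le> osc T x (mesh u) powr p"
proof -
  define f where "f i = \<bar>increment x u t i\<bar> powr p * indicator {0..s} (min (u ! i) t)
    - \<bar>increment x u s i\<bar> powr p" for i
  note P = partition[OF u]
  \<comment> \<open>An interval ending by \<open>s\<close> contributes the same to both sums, and
    one starting after \<open>s\<close> contributes nothing. For \<open>s = t\<close> the indicator
    does not cut off the latter, but the increment stopped at \<open>t\<close> vanishes.\<close>
  have straddle: "u ! i \<le> s \<and> s < u ! Suc i" if i: "i < num_intervals u" and f: "f i \<noteq> 0" for i
  proof -
    have "0 \<le> u ! i" "u ! i < u ! Suc i" "u ! Suc i \<le> T"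
      using i P(6)[of i] P(6)[of "Suc i"] P(4)[of i "Suc i"] by auto
    then have "f i = 0" if "s < u ! i \<or> u ! Suc i \<le> s"
      using that s t by (cases "s = t") (auto simp: f_def increment_def indicator_def min_def)
    then show ?thesis using f by linarith
  qed
  have "\<bar>sum f {..<num_intervals u}\<bar> \<le> osc T x (mesh u) powr p"
  proof (rule sum_single_index_le)
    fix i assume i: "i \<in> {..<num_intervals u}"
    have bound: "\<bar>increment x u r i\<bar> powr p \<le> osc T x (mesh u) powr p" if "r \<in> {0..T}" for r
      using increment_le_osc[OF u _ that] i p_pos by (intro powr_mono2) auto
    show "\<bar>f i\<bar> \<le> osc T x (mesh u) powr p"
    proof -
      let ?a = "\<bar>increment x u t i\<bar> powr p" and ?b = "\<bar>increment x u s i\<bar> powr p"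
      have "f i = ?a - ?b \<or> f i = - ?b" by (auto simp: f_def indicator_def)
      moreover have "0 \<le> ?a" "0 \<le> ?b" by simp_all
      moreover have "?a \<le> osc T x (mesh u) powr p" "?b \<le> osc T x (mesh u) powr p"
        using bound[of s] bound[of t] s t by auto
      ultimately show ?thesis by linarith
    qed
  next
    fix i j assume ij: "i \<in> {..<num_intervals u}" "j \<in> {..<num_intervals u}" "f i \<noteq> 0" "f j \<noteq> 0"
    then have "u ! i \<le> s" "s < u ! Suc i" "u ! j \<le> s" "s < u ! Suc j"
      using straddle by auto
    then show "i = j"
      using P(5)[of "Suc i" j] P(5)[of "Suc j" i] ij by (cases i j rule: linorder_cases) auto
  qed auto
  then show ?thesis by (simp add: f_def pth_sum_def sum_subtractf)
qed

lemma cdf_diff_pth_sum_tendsto_0: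
  assumes u: "vanishing_partitions T u" and "0 \<le> s" "s \<le> t" "t \<le> T"
  shows "(\<lambda>n. (\<Sum>i<num_intervals (u n). \<bar>increment x (u n) t i\<bar> powr p *
    indicator {0..s} (min (u n ! i) t)) - pth_sum p x (u n) s) \<longlonglongrightarrow> 0"
proof (rule Lim_null_comparison)
  show "\<forall>\<^sub>F n in sequentially. norm ((\<Sum>i<num_intervals (u n). \<bar>increment x (u n) t i\<bar> powr p *
    indicator {0..s} (min (u n ! i) t)) - pth_sum p x (u n) s) \<le> osc T x (mesh (u n)) powr p"
    using cdf_diff_pth_sum_le[OF vanishingD(1)[OF u] assms(2-)] by simp
  have "(\<lambda>n. osc T x (mesh (u n)) powr p) \<longlonglongrightarrow> 0 powr p"
    using osc_mesh_tendsto_0[OF u cont] p_pos osc_nonneg[OF cont _ vanishingD(3)[OF u]] T_pos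
    by (intro tendsto_powr2) auto
  then show "(\<lambda>n. osc T x (mesh (u n)) powr p) \<longlonglongrightarrow> 0" by simp
qed

section \<open>Limit variation and occupation measures in terms of power sums\<close>

text \<open>Stopping at \<open>T\<close> changes no partition point; this form makes the integral
  the case \<open>t = T\<close> of the stopped sums.\<close>

lemma integral_variation_measure:
  fixes f :: "real \<Rightarrow> real"
  assumes u: "is_partition T u" and f: "continuous_on {0..T} f"
  shows "(\<integral>y. f y \<partial>variation_measure T p x u) =
    (\<Sum>i<num_intervals u. \<bar>increment x u T i\<bar> powr p * f (min (u ! i) T))"
proof -
  have "(\<integral>y. f y \<partial>variation_measure T p x u) =
      (\<Sum>i<num_intervals u. \<bar>x (u ! Suc i) - x (u ! i)\<bar> powr p * f (u ! i))"
    unfolding variation_measure_def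
    using borel_measurable_continuous_on_restrict[OF f] partition(6)[OF u]
    by (intro integral_weighted_diracs) (auto simp: space_restrict_space)
  also have "\<dots> = (\<Sum>i<num_intervals u. \<bar>increment x u T i\<bar> powr p * f (min (u ! i) T))"
    using partition(6)[OF u] by (intro sum.cong) (auto simp: increment_def min_def Suc_le_eq)
  finally show ?thesis .
qed

text \<open>Weak convergence to a measure without atoms gives convergence of the distribution
  functions, and these are asymptotically the power sums.\<close>

lemma pth_sum_tendsto_of_limit_variation:
  assumes u: "vanishing_partitions T u" and lim: "is_limit_variation T p u x \<mu>"
    and t: "t \<in> {0..T}"
  shows "(\<lambda>n. pth_sum p x (u n) t) \<longlonglongrightarrow> measure \<mu> {0..t}"
proof -
  have s: "sets \<mu> = sets (restrict_space borel {0..T})" and fin: "finite_measure \<mu>"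
    and na: "nonatomic \<mu>" and w: "weakly_converges (\<lambda>n. variation_measure T p x (u n)) \<mu>"
    using lim by (auto simp: is_limit_variation_def)
  have "(\<lambda>n. \<Sum>i<num_intervals (u n). \<bar>increment x (u n) T i\<bar> powr p *
      indicator {0..t} (min (u n ! i) T)) \<longlonglongrightarrow> measure \<mu> {0..t}"
  proof (rule cdf_tendsto_of_integral_tendsto[OF s fin na _ _ _ t])
    fix f :: "real \<Rightarrow> real" assume f: "continuous_on {0..T} f"
    then have "bounded (f ` {0..T})"
      by (intro compact_imp_bounded compact_continuous_image) auto
    then have "(\<lambda>n. \<integral>y. f y \<partial>variation_measure T p x (u n)) \<longlonglongrightarrow> (\<integral>y. f y \<partial>\<mu>)"
      using w f by (auto simp: weakly_converges_def Icc_sets[OF s])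
    then show "(\<lambda>n. \<Sum>i<num_intervals (u n). \<bar>increment x (u n) T i\<bar> powr p *
        f (min (u n ! i) T)) \<longlonglongrightarrow> (\<integral>y. f y \<partial>\<mu>)"
      by (simp add: integral_variation_measure[OF vanishingD(1)[OF u] f])
  qed (use partition(6)[OF vanishingD(1)[OF u]] in \<open>auto simp: min_def\<close>)
  from tendsto_diff[OF this cdf_diff_pth_sum_tendsto_0[OF u, of t T]] t show ?thesis by simp
qed

context
  fixes \<mu> :: "real measure" and u :: "nat \<Rightarrow> real list"
  assumes u: "vanishing_partitions T u"
    and s: "sets \<mu> = sets (restrict_space borel {0..T})" and fin: "finite_measure \<mu>"
    and lim: "\<And>t. t \<in> {0..T} \<Longrightarrow> (\<lambda>n. pth_sum p x (u n) t) \<longlonglongrightarrow> measure \<mu> {0..t}"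
begin

text \<open>The weights stopped at \<open>t\<close> form a discrete measure on \<open>[0,t]\<close>
  whose distribution function at \<open>r\<close> is asymptotically
  \<open>pth_sum p x (u n) r\<close>. So \<open>integral_tendsto_of_cdf_tendsto\<close> applies with
  \<open>t\<close> in the role of \<open>T\<close>.\<close>

lemma weighted_sum_tendsto:
  fixes g :: "real \<Rightarrow> real"
  assumes t: "t \<in> {0..T}" and g: "continuous_on {0..T} g"
  shows "(\<lambda>n. \<Sum>i<num_intervals (u n). \<bar>increment x (u n) t i\<bar> powr p * g (min (u n ! i) t))
    \<longlonglongrightarrow> (\<integral>y. g y \<partial>restrict_space \<mu> {0..t})"
proof (rule integral_tendsto_of_cdf_tendsto)
  have *: "{0..t} \<inter> space \<mu> \<in> sets \<mu>" using Icc_sets[OF s] t by auto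
  have "sets (restrict_space \<mu> {0..t}) = sets (restrict_space (restrict_space borel {0..T}) {0..t})"
    by (rule sets_restrict_space_cong[OF s])
  also have "restrict_space (restrict_space borel {0..T}) {0..t} = restrict_space borel {0..t}"
    using t by (subst restrict_restrict_space) (auto simp: Int_absorb1)
  finally show "sets (restrict_space \<mu> {0..t}) = sets (restrict_space borel {0..t})" .
  show "finite_measure (restrict_space \<mu> {0..t})"
    using finite_measure_restrict_space[OF fin Icc_sets(2)[OF s t]] .
  show "(\<lambda>n. \<Sum>i<num_intervals (u n). \<bar>increment x (u n) t i\<bar> powr p *
      indicator {0..r} (min (u n ! i) t)) \<longlonglongrightarrow> measure (restrict_space \<mu> {0..t}) {0..r}"
    if r: "r \<in> {0..t}" for r
  proof -
    have "measure (restrict_space \<mu> {0..t}) {0..r} = measure \<mu> {0..r}"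
      using r * by (intro measure_restrict_space) auto
    then show ?thesis
      using tendsto_add[OF cdf_diff_pth_sum_tendsto_0[OF u, of r t] lim[of r]] r t by simp
  qed
  show "continuous_on {0..t} g" using g by (rule continuous_on_subset) (use t in auto)
  show "min (u n ! i) t \<in> {0..t}" if "i < num_intervals (u n)" for n i
    using partition(6)[OF vanishingD(1)[OF u], of i n] that t by auto
qed (use t in auto)

text \<open>A converse to \<open>pth_sum_tendsto_of_limit_variation\<close>: this is
  \<open>weighted_sum_tendsto\<close> at \<open>t = T\<close>, where the restriction of
  \<open>\<mu>\<close> is invisible.\<close>

lemma is_limit_variationI:
  assumes na: "nonatomic \<mu>"
  shows "is_limit_variation T p u x \<mu>"
  unfolding is_limit_variation_def weakly_converges_def
proof (intro conjI allI impI s fin na)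
  fix f :: "real \<Rightarrow> real" assume "continuous_on (space \<mu>) f \<and> bounded (f ` space \<mu>)"
  then have f: "continuous_on {0..T} f" by (simp add: Icc_sets[OF s])
  have "(\<integral>y. f y \<partial>restrict_space \<mu> {0..T}) = (\<integral>y. indicator {0..T} y *\<^sub>R f y \<partial>\<mu>)"
    using Icc_sets[OF s] T_pos by (intro integral_restrict_space) auto
  also have "\<dots> = (\<integral>y. f y \<partial>\<mu>)"
    by (intro Bochner_Integration.integral_cong) (auto simp: Icc_sets[OF s])
  finally show "(\<lambda>n. \<integral>y. f y \<partial>variation_measure T p x (u n)) \<longlonglongrightarrow> (\<integral>y. f y \<partial>\<mu>)"
    using weighted_sum_tendsto[OF _ f, of T] T_pos
    by (simp add: integral_variation_measure[OF vanishingD(1)[OF u] f])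
qed

end

text \<open>Resolves the definite description: every candidate has the limits of the power sums as
  its distribution function.\<close>

lemma limit_variation_eqI:
  assumes u: "vanishing_partitions T u" and lim: "is_limit_variation T p u x \<mu>"
  shows "limit_variation T p u x = \<mu>"
  unfolding limit_variation_def
proof (rule the_equality)
  fix \<mu>' assume lim': "is_limit_variation T p u x \<mu>'"
  have "measure \<mu>' {0..t} = measure \<mu> {0..t}" if "t \<in> {0..T}" for t
    using pth_sum_tendsto_of_limit_variation[OF u lim' that]
      pth_sum_tendsto_of_limit_variation[OF u lim that] by (rule LIMSEQ_unique)
  then show "\<mu>' = \<mu>"
    using lim lim' T_pos by (intro measure_eqI_Icc[of _ T]) (auto simp: is_limit_variation_def)
qed (rule lim)

lemma integral_occupation_measure:
  fixes f :: "real \<Rightarrow> real"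
  assumes "continuous_on UNIV f"
  shows "(\<integral>y. f y \<partial>occupation_measure p x u t) =
    (\<Sum>i<num_intervals u. \<bar>increment x u t i\<bar> powr p * f (x (min (u ! i) t)))"
  unfolding occupation_measure_def increment_def
  using borel_measurable_continuous_onI[OF assms] by (intro integral_weighted_diracs) auto

lemma integral_limit_occupation:
  fixes f :: "real \<Rightarrow> real"
  assumes s: "sets (limit_variation T p u x) = sets (restrict_space borel {0..T})"
    and f: "continuous_on UNIV f"
  shows "(\<integral>y. f y \<partial>limit_occupation T p u x t) =
    (\<integral>y. f (x y) \<partial>restrict_space (limit_variation T p u x) {0..t})"
proof -
  have "x \<in> borel_measurable (limit_variation T p u x)"
    unfolding measurable_cong_sets[OF s refl]
    by (rule borel_measurable_continuous_on_restrict[OF cont])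
  then show ?thesis
    unfolding limit_occupation_def using borel_measurable_continuous_onI[OF f]
    by (intro integral_distr measurable_restrict_space1) auto
qed

text \<open>From left to right, the constant test function 1 extracts the total masses. From right
  to left, a test function \<open>f\<close> becomes the continuous weight \<open>f (x y)\<close> on
  \<open>[0,t]\<close>, and \<open>weighted_sum_tendsto\<close> applies.\<close>

lemma occupation_weakly_converges_iff:
  assumes u: "vanishing_partitions T u" and v: "vanishing_partitions T v"
    and lim: "is_limit_variation T p v x \<mu>"
  shows "(\<forall>t\<in>{0..T}. weakly_converges (\<lambda>n. occupation_measure p x (u n) t) (limit_occupation T p v x t))
    \<longleftrightarrow> (\<forall>t\<in>{0..T}. (\<lambda>n. pth_sum p x (u n) t) \<longlonglongrightarrow> measure \<mu> {0..t})" (is "?L \<longleftrightarrow> ?R")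
proof -
  have s: "sets \<mu> = sets (restrict_space borel {0..T})" and fin: "finite_measure \<mu>"
    using lim by (auto simp: is_limit_variation_def)
  note \<mu> = limit_variation_eqI[OF v lim]
  have sp: "space (limit_occupation T p v x t) = UNIV" for t
    by (simp add: limit_occupation_def)
  note occ = integral_occupation_measure
    integral_limit_occupation[where u=v, unfolded \<mu>, OF s]
  have "(\<lambda>n. pth_sum p x (u n) t) \<longlonglongrightarrow> measure \<mu> {0..t}" if ?L and t: "t \<in> {0..T}" for t
  proof -
    have "(\<lambda>n. \<integral>y. (1::real) \<partial>occupation_measure p x (u n) t) \<longlonglongrightarrow> (\<integral>y. (1::real) \<partial>limit_occupation T p v x t)"
    proof -
      have "weakly_converges (\<lambda>n. occupation_measure p x (u n) t) (limit_occupation T p v x t)"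
        using that by blast
      then show ?thesis
        unfolding weakly_converges_def sp by (elim allE[of _ "\<lambda>_. 1"])
          (auto simp: image_constant_conv simp del: lebesgue_integral_const)
    qed
    moreover have "space \<mu> \<inter> {0..t} = {0..t}" using Icc_sets(1)[OF s] t by auto
    moreover have "measure (restrict_space \<mu> {0..t}) {0..t} = measure \<mu> {0..t}"
      using Icc_sets[OF s] t by (intro measure_restrict_space) auto
    ultimately show ?thesis
      by (simp add: occ(1)[of "\<lambda>_. 1"] occ(2)[of "\<lambda>_. 1"] pth_sum_def space_restrict_space Int_commute
          del: lebesgue_integral_const) (simp add: space_restrict_space Int_commute)
  qed
  moreover have "weakly_converges (\<lambda>n. occupation_measure p x (u n) t) (limit_occupation T p v x t)"
    if ?R and t: "t \<in> {0..T}" for t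
    unfolding weakly_converges_def sp
  proof (intro allI impI, elim conjE)
    fix f :: "real \<Rightarrow> real" assume f: "continuous_on UNIV f"
    have "continuous_on {0..T} (\<lambda>y. f (x y))"
      using f cont by (rule continuous_on_compose2) auto
    from weighted_sum_tendsto[OF u s fin _ t this] \<open>?R\<close>
    show "(\<lambda>n. \<integral>y. f y \<partial>occupation_measure p x (u n) t) \<longlonglongrightarrow> (\<integral>y. f y \<partial>limit_occupation T p v x t)"
      by (simp add: occ[OF f])
  qed
  ultimately show ?thesis by blast
qed

section \<open>Coarse-graining along an alignment\<close>

text \<open>The two special values in \<open>kappa\<close> agree with the general minimum: both
  partitions start at 0, and \<open>v\<close> reaches \<open>T\<close> only at its last index. Hence
  one description serves all \<open>k\<close>.\<close>

lemma
  assumes u: "is_partition T u" and v: "is_partition T v" and k: "k \<le> num_intervals u"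
  shows kappa_le: "kappa u v k \<le> num_intervals v"
    and nth_kappa_ge: "u ! k \<le> v ! kappa u v k"
    and less_kappaD: "j < kappa u v k \<Longrightarrow> v ! j < u ! k"
proof -
  note U = partition[OF u] and V = partition[OF v]
  have "kappa u v k \<le> num_intervals v \<and> u ! k \<le> v ! kappa u v k \<and>
    (\<forall>j<kappa u v k. v ! j < u ! k)"
  proof -
    consider "k = 0" | "k = num_intervals u" "k \<noteq> 0" | "k \<noteq> 0" "k \<noteq> num_intervals u" by blast
    then show ?thesis
    proof cases
      case 1
      then show ?thesis using U V by (simp add: kappa_def)
    next
      case 2
      then show ?thesis using U(3) V(3) V(4)[of _ "num_intervals v"] by (simp add: kappa_def)
    next
      case 3
      define P where "P j \<longleftrightarrow> j \<le> num_intervals v \<and> u ! k \<le> v ! j" for j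
      have *: "kappa u v k = (LEAST j. P j)" using 3 by (simp add: kappa_def P_def)
      \<comment> \<open>The last fine point is \<open>T\<close>, so the set under
        \<open>LEAST\<close> is nonempty.\<close>
      have "P (num_intervals v)" using U(6)[OF k] V(3) by (simp add: P_def)
      then have "P (kappa u v k)" unfolding * by (rule LeastI)
      moreover have "\<not> P j" if "j < kappa u v k" for j
        using that unfolding * by (rule not_less_Least)
      ultimately show ?thesis unfolding P_def by (auto simp: not_le)
    qed
  qed
  then show "kappa u v k \<le> num_intervals v" "u ! k \<le> v ! kappa u v k"
    "j < kappa u v k \<Longrightarrow> v ! j < u ! k" by auto
qed

lemma kappa_mono:
  assumes u: "is_partition T u" and v: "is_partition T v" and k: "k < num_intervals u"
  shows "kappa u v k \<le> kappa u v (Suc k)"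
proof (rule ccontr)
  assume "\<not> kappa u v k \<le> kappa u v (Suc k)"
  then have "v ! kappa u v (Suc k) < u ! k" using less_kappaD[OF u v] k by auto
  also have "u ! k < u ! Suc k" using partition(4)[OF u] k by auto
  finally show False using nth_kappa_ge[OF u v, of "Suc k"] k by auto
qed

text \<open>The fine point before index \<open>kappa u v k\<close> lies below \<open>u ! k\<close>,
  so one fine interval contains \<open>u ! k\<close>; at index 0 both points are 0.\<close>

lemma nth_kappa_dist:
  assumes u: "is_partition T u" and v: "is_partition T v" and k: "k \<le> num_intervals u"
  shows "\<bar>v ! kappa u v k - u ! k\<bar> \<le> mesh v"
proof (cases "kappa u v k")
  case 0
  then show ?thesis
    using nth_kappa_ge[OF u v k] partition(6)[OF u k] partition(2,8)[OF v] by auto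
next
  case (Suc j)
  then show ?thesis
    using nth_kappa_ge[OF u v k] less_kappaD[OF u v k, of j] partition(7)[OF v, of j]
      kappa_le[OF u v k] by auto
qed

text \<open>The blocks tile the fine indices, \<open>kappa u v\<close> being monotone from 0 to
  \<open>num_intervals v\<close>.\<close>

lemma sum_blocks:
  assumes u: "is_partition T u" and v: "is_partition T v"
  shows "(\<Sum>k<num_intervals u. \<Sum>j\<in>{kappa u v k..<kappa u v (Suc k)}. f j) =
    (\<Sum>j<num_intervals v. f j :: real)"
proof -
  have "(\<Sum>k<m. \<Sum>j\<in>{kappa u v k..<kappa u v (Suc k)}. f j) = (\<Sum>j<kappa u v m. f j)"
    if "m \<le> num_intervals u" for m
    using that
  proof (induction m)
    case (Suc m)
    then show ?case
      using kappa_mono[OF u v, of m] sum.atLeastLessThan_concat[of 0 "kappa u v m" "kappa u v (Suc m)" f]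
      by (simp add: lessThan_atLeast0)
  qed (simp add: kappa_def)
  from this[of "num_intervals u"] show ?thesis
    using partition(1)[OF u] by (simp add: kappa_def)
qed

text \<open>The block increment telescopes to an increment of \<open>x\<close> between two fine
  points. Each lies within \<open>mesh v\<close> of the matching coarse point, and stopping at
  \<open>t\<close> does not enlarge distances.\<close>

lemma block_increment_diff_le:
  assumes u: "is_partition T u" and v: "is_partition T v" and k: "k < num_intervals u"
    and t: "t \<in> {0..T}"
  shows "\<bar>block_increment x u v t k - increment x u t k\<bar> \<le> 2 * osc T x (mesh v)"
proof -
  have "block_increment x u v t k =
      x (min (v ! kappa u v (Suc k)) t) - x (min (v ! kappa u v k) t)"
    unfolding block_increment_def increment_def
    using sum_Suc_diff'[OF kappa_mono[OF u v k], of "\<lambda>j. x (min (v ! j) t)"] .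
  moreover have "\<bar>x (min (v ! kappa u v l) t) - x (min (u ! l) t)\<bar> \<le> osc T x (mesh v)"
    if l: "l \<le> num_intervals u" for l
    using nth_kappa_dist[OF u v l] partition(6)[OF u l] partition(6)[OF v kappa_le[OF u v l]] t
    by (intro osc_upper[OF cont]) (auto simp: min_def)
  from this[of k] this[of "Suc k"] k
  have "\<bar>x (min (v ! kappa u v (Suc k)) t) - x (min (u ! Suc k) t)\<bar> \<le> osc T x (mesh v)"
    "\<bar>x (min (v ! kappa u v k) t) - x (min (u ! k) t)\<bar> \<le> osc T x (mesh v)" by auto
  ultimately show ?thesis unfolding increment_def by linarith
qed

lemma sum_block_error:
  assumes u: "is_partition T u" and v: "is_partition T v"
  shows "(\<Sum>k<num_intervals u. block_error p x u v t k) =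
    (\<Sum>k<num_intervals u. \<bar>block_increment x u v t k\<bar> powr p) - pth_sum p x v t"
  using sum_blocks[OF u v, of "\<lambda>j. \<bar>increment x v t j\<bar> powr p"]
  by (simp add: block_error_def pth_sum_def sum_subtractf)

text \<open>The fine points of block \<open>k\<close> lie between \<open>u ! k\<close> and
  \<open>u ! Suc k\<close>, so evaluating \<open>g\<close> at the coarse point costs at most its
  oscillation at the coarse mesh.\<close>

lemma sum_blocks_weighted_le:
  fixes g :: "real \<Rightarrow> real"
  assumes u: "is_partition T u" and v: "is_partition T v" and t: "t \<in> {0..T}"
    and g: "continuous_on {0..T} g"
  shows "\<bar>(\<Sum>j<num_intervals v. \<bar>increment x v t j\<bar> powr p * g (min (v ! j) t))
    - (\<Sum>k<num_intervals u. (\<Sum>j\<in>{kappa u v k..<kappa u v (Suc k)}. \<bar>increment x v t j\<bar> powr p) * g (u ! k))\<bar>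
    \<le> osc T g (mesh u) * pth_sum p x v t"
proof -
  let ?B = "\<lambda>k. {kappa u v k..<kappa u v (Suc k)}" and ?w = "\<lambda>j. \<bar>increment x v t j\<bar> powr p"
  have le: "\<bar>?w j * (g (min (v ! j) t) - g (u ! k))\<bar> \<le> osc T g (mesh u) * ?w j"
    if k: "k < num_intervals u" and j: "j \<in> ?B k" for k j
  proof -
    have jv: "j < num_intervals v" using kappa_le[OF u v, of "Suc k"] k j by auto
    have kap: "kappa u v k \<le> j" "j < kappa u v (Suc k)" using j by auto
    have lo: "u ! k \<le> v ! j"
      using nth_kappa_ge[OF u v, of k] partition(5)[OF v kap(1)] jv k by auto
    have hi: "v ! j < u ! Suc k" using less_kappaD[OF u v _ kap(2)] k by auto
    show ?thesis
    proof (cases "v ! j < t")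
      case True
      have "\<bar>g (v ! j) - g (u ! k)\<bar> \<le> osc T g (mesh u)"
        using lo hi partition(7)[OF u k] partition(6)[OF u, of k] partition(6)[OF v, of j] jv k
        by (intro osc_upper[OF g]) auto
      then show ?thesis using True
        by (simp add: abs_mult mult.commute[of "osc T g (mesh u)"] mult_left_mono)
    next
      \<comment> \<open>Here stopping would replace \<open>v ! j\<close> by \<open>t\<close>, but
        the weight is 0.\<close>
      case False
      then have "increment x v t j = 0"
        using partition(4)[OF v, of j "Suc j"] jv by (intro increment_eq_0) auto
      then show ?thesis by simp
    qed
  qed
  have "(\<Sum>j<num_intervals v. ?w j * g (min (v ! j) t))
      - (\<Sum>k<num_intervals u. (\<Sum>j\<in>?B k. ?w j) * g (u ! k))
      = (\<Sum>k<num_intervals u. \<Sum>j\<in>?B k. ?w j * (g (min (v ! j) t) - g (u ! k)))"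
    unfolding sum_blocks[OF u v, symmetric]
    by (simp add: sum_subtractf right_diff_distrib sum_distrib_right)
  also have "\<bar>\<dots>\<bar> \<le> (\<Sum>k<num_intervals u. \<Sum>j\<in>?B k. osc T g (mesh u) * ?w j)"
    using le by (intro order_trans[OF sum_abs] sum_mono) auto
  also have "\<dots> = osc T g (mesh u) * pth_sum p x v t"
    by (simp add: sum_blocks[OF u v] pth_sum_def sum_distrib_left)
  finally show ?thesis .
qed

text \<open>For fixed \<open>n\<close> the factor \<open>num_intervals (\<pi> n)\<close> is constant
  while the oscillation along \<open>\<rho>\<close> vanishes. So \<open>r n\<close> can be chosen
  successively, beyond the previous index and with product below \<open>1 / Suc n\<close>.\<close>

lemma alignment_exists:
  assumes \<rho>: "vanishing_partitions T \<rho>"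
  shows "\<exists>r. is_alignment T p x \<pi> \<rho> r"
proof -
  have lim: "(\<lambda>m. c * osc T x (mesh (\<rho> m)) powr p) \<longlonglongrightarrow> 0" for c
  proof -
    have "(\<lambda>m. osc T x (mesh (\<rho> m)) powr p) \<longlonglongrightarrow> 0 powr p"
      using osc_mesh_tendsto_0[OF \<rho> cont] p_pos osc_nonneg[OF cont _ vanishingD(3)[OF \<rho>]] T_pos
      by (intro tendsto_powr2) auto
    then show ?thesis using tendsto_mult_right_zero[of _ _ c] by simp
  qed
  have "\<exists>k>m. real (num_intervals (\<pi> n)) * osc T x (mesh (\<rho> k)) powr p < 1 / real (Suc n)" for m n
  proof -
    have "\<forall>\<^sub>F k in sequentially. m < k \<and>
        real (num_intervals (\<pi> n)) * osc T x (mesh (\<rho> k)) powr p < 1 / real (Suc n)"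
      using order_tendstoD(2)[OF lim] by (intro eventually_conj eventually_gt_at_top) auto
    then show ?thesis by (auto simp: eventually_sequentially)
  qed
  then obtain r where r: "\<And>n. r n < r (Suc n)"
    "\<And>n. real (num_intervals (\<pi> n)) * osc T x (mesh (\<rho> (r n))) powr p < 1 / real (Suc n)"
    using dependent_nat_choice[of
      "\<lambda>n k. real (num_intervals (\<pi> n)) * osc T x (mesh (\<rho> k)) powr p < 1 / real (Suc n)"
      "\<lambda>n k l. k < l"] by (metis (no_types, lifting))
  have "(\<lambda>n. real (num_intervals (\<pi> n)) * osc T x (mesh (\<rho> (r n))) powr p) \<longlonglongrightarrow> 0"
  proof (rule Lim_null_comparison)
    show "\<forall>\<^sub>F n in sequentially.
        norm (real (num_intervals (\<pi> n)) * osc T x (mesh (\<rho> (r n))) powr p) \<le> 1 / real (Suc n)"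
      using r(2) by (intro always_eventually) (auto intro: less_imp_le)
    show "(\<lambda>n. 1 / real (Suc n)) \<longlonglongrightarrow> 0" by real_asymp
  qed
  then show ?thesis
    unfolding is_alignment_def using r(1) by (auto simp: strict_mono_Suc_iff)
qed

section \<open>Limits along a fixed alignment\<close>

context
  fixes \<pi> \<rho> :: "nat \<Rightarrow> real list" and r :: "nat \<Rightarrow> nat"
  assumes \<pi>: "vanishing_partitions T \<pi>" and \<rho>: "vanishing_partitions T \<rho>"
    and r: "is_alignment T p x \<pi> \<rho> r"
begin

lemma vanishing_aligned: "vanishing_partitions T (\<lambda>n. \<rho> (r n))"
  using \<rho> r LIMSEQ_subseq_LIMSEQ[of "\<lambda>n. mesh (\<rho> n)" 0 r]
  by (auto simp: vanishing_partitions_def is_alignment_def o_def)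

lemma block_increment_diff_tendsto_0:
  assumes t: "t \<in> {0..T}"
  shows "(\<lambda>n. \<Sum>k<num_intervals (\<pi> n).
    \<bar>block_increment x (\<pi> n) (\<rho> (r n)) t k - increment x (\<pi> n) t k\<bar> powr p) \<longlonglongrightarrow> 0"
proof (rule Lim_null_comparison)
  let ?o = "\<lambda>n. osc T x (mesh (\<rho> (r n)))"
  have "(\<Sum>k<num_intervals (\<pi> n).
      \<bar>block_increment x (\<pi> n) (\<rho> (r n)) t k - increment x (\<pi> n) t k\<bar> powr p)
      \<le> 2 powr p * (real (num_intervals (\<pi> n)) * ?o n powr p)" for n
  proof -
    have "(\<Sum>k<num_intervals (\<pi> n).
        \<bar>block_increment x (\<pi> n) (\<rho> (r n)) t k - increment x (\<pi> n) t k\<bar> powr p)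
        \<le> (\<Sum>k<num_intervals (\<pi> n). (2 * ?o n) powr p)"
      using block_increment_diff_le[OF vanishingD(1)[OF \<pi>] vanishingD(1)[OF \<rho>] _ t] p_pos
      by (intro sum_mono powr_mono2) auto
    then show ?thesis by (simp add: powr_mult mult_ac)
  qed
  then show "\<forall>\<^sub>F n in sequentially. norm (\<Sum>k<num_intervals (\<pi> n).
      \<bar>block_increment x (\<pi> n) (\<rho> (r n)) t k - increment x (\<pi> n) t k\<bar> powr p)
      \<le> 2 powr p * (real (num_intervals (\<pi> n)) * ?o n powr p)"
    by (simp add: sum_nonneg)
  show "(\<lambda>n. 2 powr p * (real (num_intervals (\<pi> n)) * ?o n powr p)) \<longlonglongrightarrow> 0"
    using r by (intro tendsto_mult_right_zero) (auto simp: is_alignment_def)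
qed

text \<open>The block increments serve as the reference family: their p-sums equal the block errors
  plus the fine power sums, hence converge and are bounded. The coarse power sums then follow by
  closeness.\<close>

lemma pth_sum_tendsto_of_block_errors:
  assumes t: "t \<in> {0..T}" and F: "(\<lambda>n. pth_sum p x (\<rho> n) t) \<longlonglongrightarrow> F"
    and E: "(\<lambda>n. \<Sum>k<num_intervals (\<pi> n). block_error p x (\<pi> n) (\<rho> (r n)) t k) \<longlonglongrightarrow> 0"
  shows "(\<lambda>n. pth_sum p x (\<pi> n) t) \<longlonglongrightarrow> F"
proof -
  let ?C = "\<lambda>n k. block_increment x (\<pi> n) (\<rho> (r n)) t k"
  let ?I = "\<lambda>n k. increment x (\<pi> n) t k"
  have "(\<lambda>n. pth_sum p x (\<rho> (r n)) t) \<longlonglongrightarrow> F"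
    using LIMSEQ_subseq_LIMSEQ[OF F, of r] r by (simp add: is_alignment_def o_def)
  from tendsto_add[OF E this]
  have C: "(\<lambda>n. \<Sum>k<num_intervals (\<pi> n). \<bar>?C n k\<bar> powr p) \<longlonglongrightarrow> F"
    by (simp add: sum_block_error[OF vanishingD(1)[OF \<pi>] vanishingD(1)[OF \<rho>]])
  have "Bseq (\<lambda>n. \<Sum>k<num_intervals (\<pi> n). \<bar>?C n k\<bar> powr p)"
    using C by (intro convergent_imp_Bseq convergentI)
  from sum_abs_powr_diff_tendsto_0[OF p_pos this block_increment_diff_tendsto_0[OF t]]
  have "(\<lambda>n. \<Sum>k<num_intervals (\<pi> n). \<bar>\<bar>?C n k\<bar> powr p - \<bar>?I n k\<bar> powr p\<bar>) \<longlonglongrightarrow> 0" .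
  then have "(\<lambda>n. \<Sum>k<num_intervals (\<pi> n). \<bar>?C n k\<bar> powr p - \<bar>?I n k\<bar> powr p) \<longlonglongrightarrow> 0"
    by (rule Lim_null_comparison[rotated]) (auto intro!: always_eventually)
  from tendsto_diff[OF C this] show ?thesis by (simp add: pth_sum_def sum_subtractf)
qed

text \<open>The error splits into block minus coarse powers, plus coarse powers, minus fine powers
  grouped by block. The first part vanishes by alignment; the weighted sums of the other two have
  the same limit, the integral of \<open>g\<close> over \<open>[0,t]\<close>.\<close>

lemma weighted_block_errors_tendsto_0:
  fixes g :: "real \<Rightarrow> real"
  assumes s: "sets \<mu> = sets (restrict_space borel {0..T})" and fin: "finite_measure \<mu>"
    and lim_\<pi>: "\<And>t. t \<in> {0..T} \<Longrightarrow> (\<lambda>n. pth_sum p x (\<pi> n) t) \<longlonglongrightarrow> measure \<mu> {0..t}"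
    and lim_\<rho>: "\<And>t. t \<in> {0..T} \<Longrightarrow> (\<lambda>n. pth_sum p x (\<rho> n) t) \<longlonglongrightarrow> measure \<mu> {0..t}"
    and t: "t \<in> {0..T}" and g: "continuous_on {0..T} g"
  shows "(\<lambda>n. \<Sum>k<num_intervals (\<pi> n).
    block_error p x (\<pi> n) (\<rho> (r n)) t k * g (\<pi> n ! k)) \<longlonglongrightarrow> 0"
proof -
  note \<pi>n = vanishingD(1)[OF \<pi>] and \<rho>n = vanishingD(1)[OF vanishing_aligned]
  let ?N = "\<lambda>n. num_intervals (\<pi> n)"
  let ?C = "\<lambda>n k. \<bar>block_increment x (\<pi> n) (\<rho> (r n)) t k\<bar> powr p"
  let ?I = "\<lambda>n k. \<bar>increment x (\<pi> n) t k\<bar> powr p"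
  let ?J = "\<lambda>n j. \<bar>increment x (\<rho> (r n)) t j\<bar> powr p"
  let ?B = "\<lambda>n k. {kappa (\<pi> n) (\<rho> (r n)) k..<kappa (\<pi> n) (\<rho> (r n)) (Suc k)}"
  have lim_\<rho>r: "(\<lambda>n. pth_sum p x (\<rho> (r n)) t) \<longlonglongrightarrow> measure \<mu> {0..t}" if "t \<in> {0..T}" for t
    using LIMSEQ_subseq_LIMSEQ[OF lim_\<rho>[OF that], of r] r by (simp add: is_alignment_def o_def)
  obtain G where G: "G > 0" "\<And>y. y \<in> {0..T} \<Longrightarrow> \<bar>g y\<bar> \<le> G"
    using compact_continuous_image[OF g compact_Icc, THEN compact_imp_bounded]
    by (force simp: bounded_pos)
  have "(\<lambda>n. \<Sum>k<?N n. (?C n k - ?I n k) * g (\<pi> n ! k)) \<longlonglongrightarrow> 0"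
  proof (rule Lim_null_comparison)
    \<comment> \<open>Boundedness now comes from the coarse power sums, so the coarse increments are
      the reference family.\<close>
    have "Bseq (\<lambda>n. \<Sum>k<?N n. ?I n k)"
      using lim_\<pi>[OF t] unfolding pth_sum_def by (intro convergent_imp_Bseq convergentI)
    moreover have "(\<lambda>n. \<Sum>k<?N n.
        \<bar>increment x (\<pi> n) t k - block_increment x (\<pi> n) (\<rho> (r n)) t k\<bar> powr p) \<longlonglongrightarrow> 0"
      using block_increment_diff_tendsto_0[OF t] by (simp add: abs_minus_commute)
    ultimately have "(\<lambda>n. \<Sum>k<?N n. \<bar>?I n k - ?C n k\<bar>) \<longlonglongrightarrow> 0"
      by (rule sum_abs_powr_diff_tendsto_0[OF p_pos])
    then show "(\<lambda>n. (\<Sum>k<?N n. \<bar>?I n k - ?C n k\<bar>) * G) \<longlonglongrightarrow> 0"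
      by (rule tendsto_mult_left_zero)
    show "\<forall>\<^sub>F n in sequentially. norm (\<Sum>k<?N n. (?C n k - ?I n k) * g (\<pi> n ! k))
        \<le> (\<Sum>k<?N n. \<bar>?I n k - ?C n k\<bar>) * G"
    proof (intro always_eventually allI)
      fix n
      have "\<bar>(?C n k - ?I n k) * g (\<pi> n ! k)\<bar> \<le> \<bar>?I n k - ?C n k\<bar> * G" if "k < ?N n" for k
        using G(2)[OF partition(6)[OF \<pi>n]] that
        by (simp add: abs_mult abs_minus_commute mult_left_mono)
      then show "norm (\<Sum>k<?N n. (?C n k - ?I n k) * g (\<pi> n ! k))
          \<le> (\<Sum>k<?N n. \<bar>?I n k - ?C n k\<bar>) * G"
        unfolding real_norm_def sum_distrib_right
        by (intro order_trans[OF sum_abs] sum_mono) auto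
    qed
  qed
  moreover have "(\<lambda>n. \<Sum>k<?N n. ?I n k * g (\<pi> n ! k))
      \<longlonglongrightarrow> (\<integral>y. g y \<partial>restrict_space \<mu> {0..t})"
  proof -
    \<comment> \<open>Stopping the argument of \<open>g\<close> is harmless: from \<open>t\<close>
      on the coarse increments vanish.\<close>
    have "?I n k * g (\<pi> n ! k) = ?I n k * g (min (\<pi> n ! k) t)" if "k < ?N n" for n k
      using increment_eq_0[of t "\<pi> n" k x] partition(4)[OF \<pi>n, of k "Suc k" n] that
      by (cases "\<pi> n ! k < t") auto
    then have "(\<Sum>k<?N n. ?I n k * g (\<pi> n ! k)) = (\<Sum>k<?N n. ?I n k * g (min (\<pi> n ! k) t))" for n
      by (intro sum.cong) auto
    then show ?thesis using weighted_sum_tendsto[OF \<pi> s fin lim_\<pi> t g] by (simp only:)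
  qed
  moreover have "(\<lambda>n. \<Sum>k<?N n. (\<Sum>j\<in>?B n k. ?J n j) * g (\<pi> n ! k))
      \<longlonglongrightarrow> (\<integral>y. g y \<partial>restrict_space \<mu> {0..t})"
  proof -
    have "(\<lambda>n. (\<Sum>j<num_intervals (\<rho> (r n)). ?J n j * g (min (\<rho> (r n) ! j) t))
        - (\<Sum>k<?N n. (\<Sum>j\<in>?B n k. ?J n j) * g (\<pi> n ! k))) \<longlonglongrightarrow> 0"
    proof (rule Lim_null_comparison)
      show "(\<lambda>n. osc T g (mesh (\<pi> n)) * pth_sum p x (\<rho> (r n)) t) \<longlonglongrightarrow> 0"
        using tendsto_mult[OF osc_mesh_tendsto_0[OF \<pi> g] lim_\<rho>r[OF t]] by simp
    qed (use sum_blocks_weighted_le[OF \<pi>n \<rho>n t g] in \<open>simp add: always_eventually\<close>)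
    from tendsto_diff[OF weighted_sum_tendsto[OF vanishing_aligned s fin lim_\<rho>r t g] this]
    show ?thesis by simp
  qed
  ultimately have "(\<lambda>n. (\<Sum>k<?N n. (?C n k - ?I n k) * g (\<pi> n ! k)) + (\<Sum>k<?N n. ?I n k * g (\<pi> n ! k))
      - (\<Sum>k<?N n. (\<Sum>j\<in>?B n k. ?J n j) * g (\<pi> n ! k))) \<longlonglongrightarrow>
      0 + (\<integral>y. g y \<partial>restrict_space \<mu> {0..t}) - (\<integral>y. g y \<partial>restrict_space \<mu> {0..t})"
    by (intro tendsto_add tendsto_diff)
  then show ?thesis
    by (simp add: block_error_def left_diff_distrib sum_subtractf)
qed

lemma fourier_coarse_error_tendsto_0:
  assumes s: "sets \<mu> = sets (restrict_space borel {0..T})" and fin: "finite_measure \<mu>"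
    and lim_\<pi>: "\<And>t. t \<in> {0..T} \<Longrightarrow> (\<lambda>n. pth_sum p x (\<pi> n) t) \<longlonglongrightarrow> measure \<mu> {0..t}"
    and lim_\<rho>: "\<And>t. t \<in> {0..T} \<Longrightarrow> (\<lambda>n. pth_sum p x (\<rho> n) t) \<longlonglongrightarrow> measure \<mu> {0..t}"
    and t: "t \<in> {0..T}"
  shows "(\<lambda>n. fourier (coarse_error p x (\<pi> n) (\<rho> (r n)) t) \<xi>) \<longlonglongrightarrow> 0"
proof -
  have W: "(\<lambda>n. \<Sum>k<num_intervals (\<pi> n).
      block_error p x (\<pi> n) (\<rho> (r n)) t k * g (\<pi> n ! k)) \<longlonglongrightarrow> 0"
    if "continuous_on {0..T} g" for g
    by (rule weighted_block_errors_tendsto_0[OF s fin lim_\<pi> lim_\<rho> t that])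
  \<comment> \<open>Real and imaginary parts of the transform are block errors with these two
    continuous weights.\<close>
  have "continuous_on {0..T} (\<lambda>y. cos (\<xi> * x y))" "continuous_on {0..T} (\<lambda>y. sin (\<xi> * x y))"
    by (intro continuous_intros cont)+
  from this[THEN W] show ?thesis
    unfolding tendsto_complex_iff fourier_coarse_error by (simp add: Re_exp Im_exp)
qed

end

end

theorem theorem7p3:
  fixes T p :: real and x :: "real \<Rightarrow> real" and \<rho> \<pi> :: "nat \<Rightarrow> real list"
  assumes "T > 0" and "p > 1"
    and "vanishing_partitions T \<rho>"
    and "continuous_on {0..T} x" and "x \<in> V_class T p \<rho>"
    and "vanishing_partitions T \<pi>"
  shows "let
      i = x \<in> D_class T p \<pi> \<rho>;
      ii = (x \<in> V_class T p \<pi> \<and>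
              (\<forall>t\<in>{0..T}. pth_variation T p \<pi> x t = pth_variation T p \<rho> x t));
      iii = (\<forall>t\<in>{0..T}. weakly_converges
              (\<lambda>n. occupation_measure p x (\<pi> n) t) (limit_occupation T p \<rho> x t));
      iv = (\<exists>r. is_alignment T p x \<pi> \<rho> r \<and>
              (\<forall>t\<in>{0..T}. \<forall>\<xi>::real.
                (\<lambda>n. fourier (coarse_error p x (\<pi> n) (\<rho> (r n)) t) \<xi>) \<longlonglongrightarrow> 0));
      v = (\<forall>r. is_alignment T p x \<pi> \<rho> r \<longrightarrow>
              (\<forall>t\<in>{0..T}. \<forall>\<xi>::real.
                (\<lambda>n. fourier (coarse_error p x (\<pi> n) (\<rho> (r n)) t) \<xi>) \<longlonglongrightarrow> 0))
    in (i \<longleftrightarrow> ii) \<and> (i \<longleftrightarrow> iii) \<and> (i \<longleftrightarrow> iv) \<and> (i \<longleftrightarrow> v)"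
proof -
  interpret continuous_path T p x using assms by unfold_locales auto
  note \<rho> = \<open>vanishing_partitions T \<rho>\<close> and \<pi> = \<open>vanishing_partitions T \<pi>\<close>
  obtain \<mu> where \<mu>: "is_limit_variation T p \<rho> x \<mu>"
    using \<open>x \<in> V_class T p \<rho>\<close> by (auto simp: V_class_def)
  then have s: "sets \<mu> = sets (restrict_space borel {0..T})" and fin: "finite_measure \<mu>"
    and na: "nonatomic \<mu>" by (auto simp: is_limit_variation_def)
  note lim_\<rho> = pth_sum_tendsto_of_limit_variation[OF \<rho> \<mu>]
  define S where "S \<longleftrightarrow> (\<forall>t\<in>{0..T}. (\<lambda>n. pth_sum p x (\<pi> n) t) \<longlonglongrightarrow> measure \<mu> {0..t})"
  define E where "E r \<longleftrightarrow> (\<forall>t\<in>{0..T}.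
    (\<lambda>n. \<Sum>k<num_intervals (\<pi> n). block_error p x (\<pi> n) (\<rho> (r n)) t k) \<longlonglongrightarrow> 0)" for r
  define H where "H r \<longleftrightarrow> (\<forall>t\<in>{0..T}. \<forall>\<xi>::real.
    (\<lambda>n. fourier (coarse_error p x (\<pi> n) (\<rho> (r n)) t) \<xi>) \<longlonglongrightarrow> 0)" for r
  have E_S: S if "is_alignment T p x \<pi> \<rho> r" "E r" for r
    using pth_sum_tendsto_of_block_errors[OF \<pi> \<rho> that(1) _ lim_\<rho>] that(2)
    unfolding S_def E_def by blast
  have S_H: "H r" if "is_alignment T p x \<pi> \<rho> r" S for r
    using fourier_coarse_error_tendsto_0[OF \<pi> \<rho> that(1) s fin _ lim_\<rho>] that(2)
    unfolding S_def H_def by blast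
  have H_E: "E r" if "H r" for r
    unfolding E_def
  proof
    fix t assume "t \<in> {0..T}"
    then have "(\<lambda>n. fourier (coarse_error p x (\<pi> n) (\<rho> (r n)) t) 0) \<longlonglongrightarrow> 0"
      using that by (auto simp: H_def)
    from tendsto_Re[OF this]
    show "(\<lambda>n. \<Sum>k<num_intervals (\<pi> n). block_error p x (\<pi> n) (\<rho> (r n)) t k) \<longlonglongrightarrow> 0"
      by (simp add: fourier_coarse_error)
  qed
  \<comment> \<open>One alignment with \<open>E r\<close> gives \<open>S\<close>, and
    \<open>S\<close> gives \<open>H r\<close> for all of them. Existence closes the cycle, as the
    universal statement then yields an actual \<open>r\<close> with \<open>H r\<close> and hence
    \<open>E r\<close>.\<close>
  have ex: "\<exists>r. is_alignment T p x \<pi> \<rho> r" by (rule alignment_exists[OF \<rho>])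
  have "x \<in> D_class T p \<pi> \<rho> \<longleftrightarrow> (\<exists>r. is_alignment T p x \<pi> \<rho> r \<and> E r)"
    by (simp add: D_class_def E_def)
  then have i: "x \<in> D_class T p \<pi> \<rho> \<longleftrightarrow> S"
    using ex E_S S_H H_E by blast
  have ii: "(x \<in> V_class T p \<pi> \<and>
      (\<forall>t\<in>{0..T}. pth_variation T p \<pi> x t = pth_variation T p \<rho> x t)) \<longleftrightarrow> S"
  proof
    assume *: "x \<in> V_class T p \<pi> \<and>
      (\<forall>t\<in>{0..T}. pth_variation T p \<pi> x t = pth_variation T p \<rho> x t)"
    then obtain \<mu>' where \<mu>': "is_limit_variation T p \<pi> x \<mu>'" by (auto simp: V_class_def)
    show S
      unfolding S_def using pth_sum_tendsto_of_limit_variation[OF \<pi> \<mu>'] *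
      by (simp add: pth_variation_def limit_variation_eqI[OF \<pi> \<mu>'] limit_variation_eqI[OF \<rho> \<mu>])
  next
    assume S
    \<comment> \<open>The limit measure along \<open>\<rho>\<close> itself serves along
      \<open>\<pi>\<close>, so both variations are read off the same measure.\<close>
    then have "is_limit_variation T p \<pi> x \<mu>"
      unfolding S_def by (intro is_limit_variationI[OF \<pi> s fin _ na]) auto
    then show "x \<in> V_class T p \<pi> \<and>
      (\<forall>t\<in>{0..T}. pth_variation T p \<pi> x t = pth_variation T p \<rho> x t)"
      using limit_variation_eqI[OF \<pi>] limit_variation_eqI[OF \<rho> \<mu>]
      by (auto simp: V_class_def pth_variation_def)
  qed
  have iii: "(\<forall>t\<in>{0..T}. weakly_converges
      (\<lambda>n. occupation_measure p x (\<pi> n) t) (limit_occupation T p \<rho> x t)) \<longleftrightarrow> S"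
    unfolding S_def by (rule occupation_weakly_converges_iff[OF \<pi> \<rho> \<mu>])
  have iv: "(\<exists>r. is_alignment T p x \<pi> \<rho> r \<and> H r) \<longleftrightarrow> S"
    and v: "(\<forall>r. is_alignment T p x \<pi> \<rho> r \<longrightarrow> H r) \<longleftrightarrow> S"
    using ex E_S S_H H_E by blast+
  show ?thesis
    unfolding Let_def i ii iii iv[unfolded H_def] v[unfolded H_def] by simp
qed

end
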